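(* Let $\omega$ be irrational and let $f:\mathbb{T}\times\mathbb{T}\to\mathbb{T}\times\mathbb{T}$, $f(\theta,\xi)=(\theta+\omega,f_\theta(\xi))$, be a continuous map such that all fiber maps $f_\theta:\mathbb{T}\to\mathbb{T}$ are orientation preserving circle homeomorphisms. Let $\mathcal{A}$ be a proper subset of $\mathbb{T}\times\mathbb{T}$ such that (i) $\mathcal{A}$ is a compact $f$-invariant set which has no isolated points, (ii) $f|_{\mathcal{A}}$ is transitive, and (iii) $\mathcal{A}$ is the topological support of a finite $f$-invariant measure. Then either $f|_{\mathcal{A}}$ has sensitive dependence, or $\mathcal{A}$ is the disjoint union of a finite number of disjoint curves which are cyclically permuted by the action of $f$.
   Context: $\mathbb{T}=\mathbb{R}/\mathbb{Z}$ is the circle. A set $\mathcal{A}$ is $f$-invariant if $f(\mathcal{A})\subseteq\mathcal{A}$ (under (i) and (ii) this forces equality). A map $g:Y\to Y$ of a metric space is transitive if there is $x\in Y$ whose forward orbit $\{g^n(x):n\in\mathbb{N}\}$ is dense in $Y$. A map $g:Y\to Y$ of a metric space $(Y,d)$ has sensitive dependence (on initial conditions) if there is $\varepsilon>0$ such that for all $\delta>0$ and $x\in Y$ there exist $n\ge 0$ and $y\in Y$ with $d(x,y)<\delta$ and $d(g^n(x),g^n(y))>\varepsilon$. The topological support of a Borel measure $\mu$ is the set of points all of whose open neighbourhoods have positive $\mu$-measure. *)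

theory Defs
  imports "HOL-Analysis.Analysis"
begin

quotient_type circle = real / "\<lambda>x y :: real. x - y \<in> \<int>"
  morphisms rep_circle to_circle
proof (rule equivpI)
  show "reflp (\<lambda>x y :: real. x - y \<in> \<int>)"
    by (simp add: reflp_def)
  show "symp (\<lambda>x y :: real. x - y \<in> \<int>)"
  proof (rule sympI)
    fix x y :: real
    assume "x - y \<in> \<int>"
    then have "- (x - y) \<in> \<int>" by (rule Ints_minus)
    then show "y - x \<in> \<int>" by simp
  qed
  show "transp (\<lambda>x y :: real. x - y \<in> \<int>)"
  proof (rule transpI)
    fix x y z :: real
    assume "x - y \<in> \<int>" "y - z \<in> \<int>"
    then have "(x - y) + (y - z) \<in> \<int>" by (rule Ints_add)
    then show "x - z \<in> \<int>" by simp
  qed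
qed

instantiation circle :: ab_group_add
begin

lift_definition zero_circle :: circle is "0 :: real" .

lift_definition plus_circle :: "circle \<Rightarrow> circle \<Rightarrow> circle" is "(+) :: real \<Rightarrow> _"
proof -
  fix x x' y y' :: real
  assume "x - x' \<in> \<int>" "y - y' \<in> \<int>"
  then have "(x - x') + (y - y') \<in> \<int>" by (rule Ints_add)
  then show "(x + y) - (x' + y') \<in> \<int>" by (simp add: algebra_simps)
qed

lift_definition uminus_circle :: "circle \<Rightarrow> circle" is "uminus :: real \<Rightarrow> _"
proof -
  fix x x' :: real
  assume "x - x' \<in> \<int>"
  then have "- (x - x') \<in> \<int>" by (rule Ints_minus)
  then show "- x - (- x') \<in> \<int>" by simp
qed

lift_definition minus_circle :: "circle \<Rightarrow> circle \<Rightarrow> circle" is "(-) :: real \<Rightarrow> _"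
proof -
  fix x x' y y' :: real
  assume "x - x' \<in> \<int>" "y - y' \<in> \<int>"
  then have "(x - x') - (y - y') \<in> \<int>" by (rule Ints_diff)
  then show "(x - y) - (x' - y') \<in> \<int>" by (simp add: algebra_simps)
qed

instance
  by standard (transfer; simp)+

end

lemma circle_norm_minimal: "\<bar>x - of_int (round x)\<bar> \<le> \<bar>x - of_int m\<bar>" for x :: real
  by (rule round_diff_minimal)

lemma circle_norm_shift:
  fixes x y :: real
  assumes "x - y \<in> \<int>"
  shows "\<bar>x - of_int (round x)\<bar> = \<bar>y - of_int (round y)\<bar>"
proof -
  have *: "\<bar>u - of_int (round u)\<bar> \<le> \<bar>v - of_int (round v)\<bar>" if "u - v \<in> \<int>" for u v :: real
  proof -
    from that obtain k where k: "u - v = of_int k" by (rule Ints_cases)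
    have "\<bar>u - of_int (round u)\<bar> \<le> \<bar>u - of_int (round v + k)\<bar>"
      by (rule circle_norm_minimal)
    also have "u - of_int (round v + k) = v - of_int (round v)" using k by linarith
    finally show ?thesis .
  qed
  have "y - x \<in> \<int>" using Ints_minus[OF assms] by simp
  then show ?thesis using *[OF assms] *[of y x] by (intro antisym)
qed

text \<open>
  The distance of two classes is the minimum of the distances of their representatives,
  that is, the distance from a difference of representatives to the nearest integer.
\<close>

instantiation circle :: metric_space
begin

lift_definition dist_circle :: "circle \<Rightarrow> circle \<Rightarrow> real"
  is "\<lambda>x y. \<bar>(x - y) - of_int (round (x - y))\<bar>"
proof (rule circle_norm_shift)
  fix x x' y y' :: real
  assume "x - x' \<in> \<int>" "y - y' \<in> \<int>"
  then have "(x - x') - (y - y') \<in> \<int>" by (rule Ints_diff)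
  then show "(x - y) - (x' - y') \<in> \<int>" by (simp add: algebra_simps)
qed

definition uniformity_circle :: "(circle \<times> circle) filter" where
  "uniformity_circle = (INF e\<in>{0<..}. principal {(x, y). dist x y < e})"

definition open_circle :: "circle set \<Rightarrow> bool" where
  "open_circle U = (\<forall>x\<in>U. \<forall>\<^sub>F (x', y) in uniformity. x' = x \<longrightarrow> y \<in> U)"

instance
proof
  show "uniformity = (INF e\<in>{0<..}. principal {(x :: circle, y). dist x y < e})"
    by (rule uniformity_circle_def)
  show "open U = (\<forall>x\<in>U. \<forall>\<^sub>F (x', y) in uniformity. x' = x \<longrightarrow> y \<in> U)" for U :: "circle set"
    by (rule open_circle_def)
  show "(dist x y = 0) = (x = y)" for x y :: circle
  proof (transfer, safe)
    fix x y :: real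
    show "x - y \<in> \<int>" if "\<bar>x - y - of_int (round (x - y))\<bar> = 0"
    proof -
      have "x - y = of_int (round (x - y))" using that by simp
      then show ?thesis by (metis Ints_of_int)
    qed
    assume "x - y \<in> \<int>"
    then obtain k where "x - y = of_int k" by (rule Ints_cases)
    then show "\<bar>x - y - of_int (round (x - y))\<bar> = 0" by simp
  qed
  show "dist x y \<le> dist x z + dist y z" for x y z :: circle
  proof transfer
    fix x y z :: real
    have "\<bar>x - y - of_int (round (x - y))\<bar>
        \<le> \<bar>x - y - of_int (round (x - z) - round (y - z))\<bar>"
      by (rule circle_norm_minimal)
    also have "\<dots> \<le> \<bar>x - z - of_int (round (x - z))\<bar> + \<bar>y - z - of_int (round (y - z))\<bar>"
      by simp
    finally show "\<bar>x - y - of_int (round (x - y))\<bar>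
        \<le> \<bar>x - z - of_int (round (x - z))\<bar> + \<bar>y - z - of_int (round (y - z))\<bar>" .
  qed
qed

end

lemma dist_to_circle_le: "dist (to_circle x) (to_circle y) \<le> \<bar>x - y\<bar>"
  using circle_norm_minimal[of "x - y" 0] by (simp add: dist_circle.abs_eq)

lemma circle_cases:
  obtains x where "p = to_circle x"
  by (induct p rule: circle.abs_induct) simp

lemma to_circle_eq_iff: "to_circle x = to_circle y \<longleftrightarrow> x - y \<in> \<int>"
  by (rule circle.abs_eq_iff)

lemma open_circle_iff_quotient: "open U \<longleftrightarrow> open (to_circle -` U)"
proof
  have cont: "continuous_on UNIV to_circle"
    unfolding continuous_on_iff by (metis dist_real_def dist_to_circle_le le_less_trans)
  show "open (to_circle -` U)" if "open U"
    using open_vimage[OF that cont] .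
next
  assume *: "open (to_circle -` U)"
  show "open U"
    unfolding open_dist
  proof
    fix p assume "p \<in> U"
    obtain x where x: "p = to_circle x" by (rule circle_cases)
    with \<open>p \<in> U\<close> have "x \<in> to_circle -` U" by simp
    then obtain e where e: "e > 0" "\<And>y. dist y x < e \<Longrightarrow> to_circle y \<in> U"
      using * unfolding open_dist by auto
    have "q \<in> U" if q: "dist q p < e" for q
    proof -
      obtain y where y: "q = to_circle y" by (rule circle_cases)
      let ?y = "y - of_int (round (y - x))"
      have "to_circle ?y = q" unfolding y by (simp add: to_circle_eq_iff)
      moreover have "dist ?y x < e"
        using q unfolding y x by (simp add: dist_circle.abs_eq dist_real_def algebra_simps)
      ultimately show ?thesis using e(2) by metis
    qed
    then show "\<exists>e>0. \<forall>y. dist y p < e \<longrightarrow> y \<in> U" using e(1) by blast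
  qed
qed

definition orientation_preserving_homeo :: "(circle \<Rightarrow> circle) \<Rightarrow> bool" where
  "orientation_preserving_homeo g \<longleftrightarrow>
     (\<exists>h. homeomorphism UNIV UNIV g h) \<and>
     (\<exists>G :: real \<Rightarrow> real. continuous_on UNIV G \<and> strict_mono G \<and>
        (\<forall>x. G (x + 1) = G x + 1) \<and> (\<forall>x. g (to_circle x) = to_circle (G x)))"

text \<open>
  A self-map of a subset \<open>Y\<close> is given by a map \<open>g\<close> of the ambient space with
  \<^prop>\<open>g ` Y \<subseteq> Y\<close>; orbits of points of \<open>Y\<close> then stay in \<open>Y\<close>.
\<close>

definition transitive_map_on :: "'a::metric_space set \<Rightarrow> ('a \<Rightarrow> 'a) \<Rightarrow> bool" where
  "transitive_map_on Y g \<longleftrightarrow> (\<exists>x\<in>Y. Y \<subseteq> closure {(g ^^ n) x |n. True})"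

definition sensitive_dependence_on :: "'a::metric_space set \<Rightarrow> ('a \<Rightarrow> 'a) \<Rightarrow> bool" where
  "sensitive_dependence_on Y g \<longleftrightarrow>
     (\<exists>\<epsilon>>0. \<forall>\<delta>>0. \<forall>x\<in>Y. \<exists>n. \<exists>y\<in>Y. dist x y < \<delta> \<and> dist ((g ^^ n) x) ((g ^^ n) y) > \<epsilon>)"

definition finite_invariant_measure :: "('a::topological_space \<Rightarrow> 'a) \<Rightarrow> 'a measure \<Rightarrow> bool" where
  "finite_invariant_measure g \<mu> \<longleftrightarrow>
     finite_measure \<mu> \<and> sets \<mu> = sets borel \<and> g \<in> measurable \<mu> \<mu> \<and> distr \<mu> \<mu> g = \<mu>"

definition topological_support :: "'a::topological_space measure \<Rightarrow> 'a set" where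
  "topological_support \<mu> = {x. \<forall>U. open U \<and> x \<in> U \<longrightarrow> emeasure \<mu> U > 0}"

definition simple_closed_curve :: "'a::topological_space set \<Rightarrow> bool" where
  "simple_closed_curve C \<longleftrightarrow>
     (\<exists>\<gamma>. simple_path \<gamma> \<and> pathfinish \<gamma> = pathstart \<gamma> \<and> path_image \<gamma> = C)"

text \<open>The curves are indexed along the cycle: \<open>g\<close> maps the \<open>i\<close>-th one onto the next.\<close>

definition cyclically_permuted_curves ::
    "('a::topological_space \<Rightarrow> 'a) \<Rightarrow> 'a set \<Rightarrow> bool" where
  "cyclically_permuted_curves g A \<longleftrightarrow>
     (\<exists>(n::nat) C. n \<ge> 1 \<and> A = (\<Union>i<n. C i) \<and> disjoint_family_on C {..<n} \<and>
        (\<forall>i<n. simple_closed_curve (C i) \<and> g ` C i = C (Suc i mod n)))"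

end

(* Suppose f restricted to A is not sensitive. A transitive point is then a point of equicontinuity;
   as the invariant measure charges every neighbourhood of it, its return times are syndetic, so f is
   minimal on A and, by compactness, uniformly equicontinuous there. Such a system is uniformly rigid
   and distal, and the projection of A to the base circle is uniformly open. Since A is proper, some
   fibre of A has a gap; its images are gaps again, and by distality they do not shrink. Minimality
   and openness of the projection carry the gap to every point of A, so the fibres are uniformly
   discrete and A is a finite covering of the circle. The components of A are thus simple closed
   curves, open in A, and minimality makes f permute them cyclically. *)

theory Submission
  imports Defs
begin

text \<open>The fibre maps need not be isometries, so the length of a gap is not preserved.
  Distality controls it only through the distance of its two end points, which both lie in
  \<open>A\<close>. If the end points coincide this gives nothing, but then the gap is a full turn
  and stays one. A uniform gap along one orbit does not survive a limit by itself: a point of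
  \<open>A\<close> inside the limiting arc could be invisible from the fibres that approach it.
  Openness of the projection rules this out by moving such a point into the nearby fibres. It comes
  from a finite Baire argument: all points of \<open>A\<close> enter a small compact piece of
  \<open>A\<close> within finitely many times, so finitely many rotated copies of its projection
  cover the circle and one has interior. The measure enters through a single count: a set of
  positive measure has only boundedly many pairwise disjoint preimages. This turns the density of
  one orbit into the density of all.\<close>

lemma funpow_mem:
  assumes "g ` Y \<subseteq> Y" "y \<in> Y"
  shows "(g ^^ n) y \<in> Y"
  using assms by (induction n) auto

lemma continuous_on_funpow:
  assumes "continuous_on Y g" "g ` Y \<subseteq> Y"
  shows "continuous_on Y (g ^^ n)"
proof (induction n)
  case (Suc n)
  have "(g ^^ n) ` Y \<subseteq> Y"
    using funpow_mem[OF assms(2)] by blast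
  then show ?case
    using Suc continuous_on_compose[of Y "g ^^ n" g] continuous_on_subset[OF assms(1)]
    by (auto simp: o_def)
qed simp

section \<open>Points of equicontinuity\<close>

text \<open>Equicontinuity at \<open>x\<close> is stability for every \<open>e > 0\<close>. The
  scale is kept as a parameter because failure of sensitivity yields, for each scale, a possibly
  different stable point.\<close>

definition stable_at :: "('a::metric_space \<Rightarrow> 'a) \<Rightarrow> 'a set \<Rightarrow> real \<Rightarrow> 'a \<Rightarrow> bool" where
  "stable_at g Y e x \<longleftrightarrow>
     (\<exists>d>0. \<forall>y\<in>Y. dist x y < d \<longrightarrow> (\<forall>n. dist ((g ^^ n) x) ((g ^^ n) y) < e))"

lemma stable_atD:
  assumes "stable_at g Y e x"
  obtains d where "d > 0" "\<And>y n. y \<in> Y \<Longrightarrow> dist x y < d \<Longrightarrow> dist ((g ^^ n) x) ((g ^^ n) y) < e"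
  using assms unfolding stable_at_def by blast

lemma stable_at_nearby:
  assumes "d > 0" "\<And>y n. y \<in> Y \<Longrightarrow> dist x y < d \<Longrightarrow> dist ((g ^^ n) x) ((g ^^ n) y) < e"
    and "z \<in> Y" "dist x z < d"
  shows "stable_at g Y (2 * e) z"
  unfolding stable_at_def
proof (intro exI conjI ballI impI allI)
  show "0 < d - dist x z" using assms by simp
  fix y n assume y: "y \<in> Y" "dist z y < d - dist x z"
  have "dist x y < d" using dist_triangle[of x y z] y by linarith
  then have "dist ((g ^^ n) x) ((g ^^ n) y) < e" "dist ((g ^^ n) x) ((g ^^ n) z) < e"
    using assms y by auto
  then show "dist ((g ^^ n) z) ((g ^^ n) y) < 2 * e"
    using dist_triangle3[of "(g ^^ n) z" "(g ^^ n) y" "(g ^^ n) x"] by linarith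
qed

locale compact_system =
  fixes g :: "'a::metric_space \<Rightarrow> 'a" and Y :: "'a set"
  assumes inv: "g ` Y \<subseteq> Y"
    and cont: "continuous_on Y g"
    and compact: "compact Y"
begin

lemma mem: "y \<in> Y \<Longrightarrow> (g ^^ n) y \<in> Y"
  using funpow_mem[OF inv] .

lemma funpow_near:
  assumes "x \<in> Y" "e > 0"
  obtains d where "d > 0" "\<And>y. y \<in> Y \<Longrightarrow> dist x y < d \<Longrightarrow> dist ((g ^^ n) x) ((g ^^ n) y) < e"
  using continuous_on_funpow[OF cont inv, of n] assms
  unfolding continuous_on_iff by (metis dist_commute)

lemma initial_segment_near:
  assumes "x \<in> Y" "e > 0"
  shows "\<exists>d>0. \<forall>y\<in>Y. dist x y < d \<longrightarrow> (\<forall>n\<le>N. dist ((g ^^ n) x) ((g ^^ n) y) < e)"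
proof (induction N)
  case 0
  show ?case using \<open>e > 0\<close> by auto
next
  case (Suc N)
  then obtain d where d: "d > 0"
    "\<forall>y\<in>Y. dist x y < d \<longrightarrow> (\<forall>n\<le>N. dist ((g ^^ n) x) ((g ^^ n) y) < e)" by blast
  obtain d' where d': "d' > 0"
    "\<And>y. y \<in> Y \<Longrightarrow> dist x y < d' \<Longrightarrow> dist ((g ^^ Suc N) x) ((g ^^ Suc N) y) < e"
    using funpow_near[OF assms] by blast
  show ?case
    by (rule exI[of _ "min d d'"]) (use d d' in \<open>auto simp: le_Suc_eq simp del: funpow.simps\<close>)
qed

text \<open>Stability moves backwards along an orbit without loss of scale: continuity controls the
  finitely many iterates up to \<open>k\<close>, and stability at \<open>(g ^^ k) x\<close> controls
  the rest.\<close>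

lemma stable_at_pullback:
  assumes "stable_at g Y e ((g ^^ k) x)" "x \<in> Y" "e > 0"
  shows "stable_at g Y e x"
proof -
  obtain d where d: "d > 0" "\<And>y n. y \<in> Y \<Longrightarrow> dist ((g ^^ k) x) y < d \<Longrightarrow>
      dist ((g ^^ n) ((g ^^ k) x)) ((g ^^ n) y) < e"
    using assms(1) by (rule stable_atD) blast
  \<comment> \<open>The bound \<open>d\<close> brings the \<open>k\<close>-th iterates into the ball
    of stability, the bound \<open>e\<close> settles the times up to \<open>k\<close>.\<close>
  obtain d1 where d1: "d1 > 0" "\<forall>y\<in>Y. dist x y < d1 \<longrightarrow>
      (\<forall>n\<le>k. dist ((g ^^ n) x) ((g ^^ n) y) < min d e)"
    using initial_segment_near[of x "min d e" k] assms d(1) by auto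
  have "dist ((g ^^ n) x) ((g ^^ n) y) < e" if y: "y \<in> Y" "dist x y < d1" for y n
  proof (cases "n \<le> k")
    case True
    then show ?thesis using d1 y by auto
  next
    case False
    have "dist ((g ^^ k) x) ((g ^^ k) y) < d" using d1 y by auto
    from d(2)[OF mem this, of "n - k"] show ?thesis
      using y False by (simp flip: funpow_add[THEN fun_cong, unfolded o_apply])
  qed
  then show ?thesis unfolding stable_at_def using d1(1) by blast
qed

text \<open>Without sensitivity at scale \<open>e / 3\<close> some ball has all its iterates close
  to those of its centre. The dense orbit enters this ball, and stability is pulled back to its
  start.\<close>

lemma transitive_point_stable:
  assumes x: "x \<in> Y" "Y \<subseteq> closure {(g ^^ n) x |n. True}"
    and nsens: "\<not> sensitive_dependence_on Y g"
    and e: "e > 0"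
  shows "stable_at g Y e x"
proof -
  have "e / 3 > 0" using e by simp
  then obtain d z where d: "d > 0" "z \<in> Y"
    "\<And>y n. y \<in> Y \<Longrightarrow> dist z y < d \<Longrightarrow> dist ((g ^^ n) z) ((g ^^ n) y) \<le> e / 3"
    using nsens unfolding sensitive_dependence_on_def by (metis not_less)
  obtain k where k: "dist ((g ^^ k) x) z < d"
    using x(2) d(1,2) unfolding closure_approachable subset_iff by blast
  \<comment> \<open>The negation of sensitivity gives only a weak inequality; passing from
    \<open>e / 3\<close> to \<open>e / 2\<close> makes it strict, and the change of centre doubles
    it to \<open>e\<close>.\<close>
  have "stable_at g Y (2 * (e / 2)) ((g ^^ k) x)"
  proof (rule stable_at_nearby[OF d(1)])
    show "dist ((g ^^ n) z) ((g ^^ n) y) < e / 2" if "y \<in> Y" "dist z y < d" for y n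
      using d(3)[OF that, of n] e by simp
    show "(g ^^ k) x \<in> Y" using mem x(1) .
    show "dist z ((g ^^ k) x) < d" using k by (simp add: dist_commute)
  qed
  then show ?thesis using stable_at_pullback x(1) e by simp
qed

end

section \<open>Return times from an invariant measure\<close>

lemma invariant_measure_funpow:
  assumes "finite_invariant_measure g \<mu>"
  shows "g ^^ n \<in> measurable \<mu> \<mu>"
    and "B \<in> sets \<mu> \<Longrightarrow> measure \<mu> ((g ^^ n) -` B \<inter> space \<mu>) = measure \<mu> B"
proof -
  have m: "g \<in> measurable \<mu> \<mu>" "distr \<mu> \<mu> g = \<mu>"
    using assms unfolding finite_invariant_measure_def by auto
  have mn: "g ^^ n \<in> measurable \<mu> \<mu>" for n
    by (induction n) (auto intro: measurable_comp m(1) measurable_compose_rev)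
  show "g ^^ n \<in> measurable \<mu> \<mu>" by fact
  show "measure \<mu> ((g ^^ n) -` B \<inter> space \<mu>) = measure \<mu> B" if B: "B \<in> sets \<mu>" for n
  proof (induction n)
    case 0
    show ?case using sets.Int_space_eq2[OF B] by simp
  next
    case (Suc n)
    have C: "(g ^^ n) -` B \<inter> space \<mu> \<in> sets \<mu>"
      using measurable_sets[OF mn B] .
    have "(g ^^ Suc n) -` B \<inter> space \<mu> = g -` ((g ^^ n) -` B \<inter> space \<mu>) \<inter> space \<mu>"
      using measurable_space[OF m(1)] by (auto simp: funpow_swap1)
    also have "measure \<mu> \<dots> = measure (distr \<mu> \<mu> g) ((g ^^ n) -` B \<inter> space \<mu>)"
      using measure_distr[OF m(1) C] by simp
    finally show ?case using Suc m(2) by metis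
  qed
qed

text \<open>A maximal family of pairwise disjoint preimages of a set of positive measure is finite;
  every further preimage meets a member of it.\<close>

lemma returns_bounded:
  assumes "finite_invariant_measure g \<mu>" "V \<in> sets \<mu>" "measure \<mu> V > 0"
  obtains F where "finite F" "\<And>n. \<exists>k\<in>F. \<exists>y. (g ^^ n) y \<in> V \<and> (g ^^ k) y \<in> V"
proof -
  interpret finite_measure \<mu>
    using assms(1) unfolding finite_invariant_measure_def by blast
  let ?W = "\<lambda>n. (g ^^ n) -` V \<inter> space \<mu>"
  have W: "?W n \<in> sets \<mu>" "measure \<mu> (?W n) = measure \<mu> V" for n
    using invariant_measure_funpow[OF assms(1)] assms(2) measurable_sets by blast+
  define P where "P F \<longleftrightarrow> finite F \<and> disjoint_family_on ?W F" for F
  have bound: "real (card F) \<le> measure \<mu> (space \<mu>) / measure \<mu> V" if "P F" for F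
  proof -
    have "real (card F) * measure \<mu> V = (\<Sum>n\<in>F. measure \<mu> (?W n))" by (simp add: W)
    also have "\<dots> = measure \<mu> (\<Union>n\<in>F. ?W n)"
      using that W(1) unfolding P_def by (intro finite_measure_finite_Union[symmetric]) auto
    also have "\<dots> \<le> measure \<mu> (space \<mu>)" by (rule bounded_measure)
    finally show ?thesis using assms(3) by (simp add: field_simps)
  qed
  have P0: "P {}" by (simp add: P_def disjoint_family_on_def)
  have "\<exists>b. \<forall>F. P F \<longrightarrow> card F < b"
  proof (intro exI allI impI)
    fix F assume "P F"
    then have "real (card F) \<le> real (nat \<lceil>measure \<mu> (space \<mu>) / measure \<mu> V\<rceil>)"
      using bound real_nat_ceiling_ge order_trans by blast
    then show "card F < nat \<lceil>measure \<mu> (space \<mu>) / measure \<mu> V\<rceil> + 1" by linarith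
  qed
  then obtain F where F: "P F" "\<And>G. P G \<Longrightarrow> card G \<le> card F"
    using P0 by (metis ex_has_greatest_nat)
  show thesis
  proof (rule that[of F])
    show "finite F" using F(1) by (simp add: P_def)
    fix n
    show "\<exists>k\<in>F. \<exists>y. (g ^^ n) y \<in> V \<and> (g ^^ k) y \<in> V"
    proof (cases "n \<in> F")
      case True
      have "?W n \<noteq> {}" using W(2)[of n] assms(3) by force
      then show ?thesis using True by blast
    next
      case False
      then have "\<not> P (insert n F)" using F(2)[of "insert n F"] F(1) by (auto simp: P_def)
      then show ?thesis using F(1) False by (fastforce simp: P_def disjoint_family_on_def)
    qed
  qed
qed

text \<open>If \<open>(g ^^ n) y\<close> and \<open>(g ^^ k) y\<close> both lie near
  \<open>x\<close>, then \<open>n - k\<close> steps carry a point near \<open>x\<close> back near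
  \<open>x\<close>, and by stability they do the same to \<open>x\<close> itself. Taking
  \<open>n = m + Max F\<close> makes \<open>n - k\<close> lie between \<open>m\<close> and
  \<open>m + Max F\<close> for every \<open>k\<close> in \<open>F\<close>.\<close>

lemma (in compact_system) syndetic_returns:
  assumes x: "x \<in> Y" "stable_at g Y e x" "e > 0"
    and \<mu>: "finite_invariant_measure g \<mu>" "\<And>r. r > 0 \<Longrightarrow> measure \<mu> (ball x r \<inter> Y) > 0"
  obtains K where "\<And>m. \<exists>i\<le>K. dist ((g ^^ i) ((g ^^ m) x)) x < 2 * e"
proof -
  obtain d where d: "d > 0"
    "\<And>y n. y \<in> Y \<Longrightarrow> dist x y < d \<Longrightarrow> dist ((g ^^ n) x) ((g ^^ n) y) < e"
    using x(2) by (rule stable_atD) blast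
  \<comment> \<open>The point \<open>y\<close> found below may lie outside \<open>Y\<close>.
    Intersecting with \<open>Y\<close> ensures that \<open>(g ^^ k) y\<close> is a point to which
    stability applies.\<close>
  define V where "V = ball x (min d e) \<inter> Y"
  have "V \<in> sets \<mu>"
    using \<mu>(1) compact_imp_closed[OF compact]
    unfolding V_def finite_invariant_measure_def by simp
  moreover have "measure \<mu> V > 0" unfolding V_def using d(1) x(3) by (intro \<mu>(2)) simp
  ultimately obtain F where F: "finite F" "\<And>n. \<exists>k\<in>F. \<exists>y. (g ^^ n) y \<in> V \<and> (g ^^ k) y \<in> V"
    using returns_bounded[OF \<mu>(1)] by metis
  show thesis
  proof (rule that[of "Max F"])
    fix m
    obtain k y where k: "k \<in> F" "(g ^^ (m + Max F)) y \<in> V" "(g ^^ k) y \<in> V"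
      using F(2) by blast
    have le: "k \<le> Max F" using F(1) k(1) by simp
    have "(g ^^ (m + Max F)) y = (g ^^ (m + (Max F - k))) ((g ^^ k) y)"
      using le by (simp flip: funpow_add[THEN fun_cong, unfolded o_apply])
    moreover have "dist ((g ^^ (m + (Max F - k))) x) ((g ^^ (m + (Max F - k))) ((g ^^ k) y)) < e"
      using k(3) by (intro d(2)) (auto simp: V_def)
    moreover have "dist x ((g ^^ (m + Max F)) y) < e" using k(2) by (simp add: V_def)
    ultimately have "dist ((g ^^ (m + (Max F - k))) x) x < 2 * e"
      using dist_triangle2[of "(g ^^ (m + (Max F - k))) x" x "(g ^^ (m + Max F)) y"] by simp
    then show "\<exists>i\<le>Max F. dist ((g ^^ i) ((g ^^ m) x)) x < 2 * e"
      by (intro exI[of _ "Max F - k"])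
        (simp add: add.commute flip: funpow_add[THEN fun_cong, unfolded o_apply])
  qed
qed

section \<open>Rigidity and distality of minimal equicontinuous systems\<close>

locale minimal_equicontinuous_system = compact_system +
  assumes nonempty: "Y \<noteq> {}"
    and minimal: "\<And>y z e. y \<in> Y \<Longrightarrow> z \<in> Y \<Longrightarrow> e > 0 \<Longrightarrow> \<exists>n. dist ((g ^^ n) y) z < e"
    and equicontinuous: "\<And>e. e > 0 \<Longrightarrow>
      \<exists>d>0. \<forall>x\<in>Y. \<forall>y\<in>Y. dist x y < d \<longrightarrow> (\<forall>n. dist ((g ^^ n) x) ((g ^^ n) y) < e)"
begin

text \<open>One close return of a single point suffices: every \<open>y\<close> is near some
  \<open>(g ^^ k) x\<close>, and since iterates commute, equicontinuity transports the return from
  \<open>x\<close> to there.\<close>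

lemma uniformly_rigid:
  assumes "e > 0"
  obtains n where "n \<ge> N" "\<And>y. y \<in> Y \<Longrightarrow> dist ((g ^^ n) y) y < e"
proof -
  obtain d where d: "d > 0"
    "\<And>x y n. x \<in> Y \<Longrightarrow> y \<in> Y \<Longrightarrow> dist x y < d \<Longrightarrow> dist ((g ^^ n) x) ((g ^^ n) y) < e / 3"
    using equicontinuous[of "e / 3"] assms by auto
  obtain x where x: "x \<in> Y" using nonempty by blast
  \<comment> \<open>Starting from \<open>(g ^^ N) x\<close> makes the return time at least
    \<open>N\<close>.\<close>
  obtain j where "dist ((g ^^ j) ((g ^^ N) x)) x < d"
    using minimal[OF mem[OF x] x d(1)] by blast
  then have ret: "dist ((g ^^ (j + N)) x) x < d" by (simp add: funpow_add)
  show thesis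
  proof (rule that[of "j + N"])
    show "dist ((g ^^ (j + N)) y) y < e" if y: "y \<in> Y" for y
    proof -
      let ?n = "j + N"
      obtain k where k: "dist ((g ^^ k) x) y < min d (e / 3)"
        using minimal[OF x y, of "min d (e / 3)"] d(1) assms by auto
      have "dist ((g ^^ ?n) ((g ^^ k) x)) ((g ^^ ?n) y) < e / 3"
        using k by (intro d(2) mem x y) simp
      moreover have "dist ((g ^^ k) ((g ^^ ?n) x)) ((g ^^ k) x) < e / 3"
        by (intro d(2) mem x ret)
      moreover have "(g ^^ k) ((g ^^ ?n) x) = (g ^^ ?n) ((g ^^ k) x)"
        by (simp add: add.commute flip: funpow_add[THEN fun_cong, unfolded o_apply])
      ultimately show ?thesis
        using k dist_triangle[of "(g ^^ ?n) y" y "(g ^^ k) x"]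
          dist_triangle3[of "(g ^^ ?n) y" "(g ^^ k) x" "(g ^^ ?n) ((g ^^ k) x)"]
        by (simp add: dist_commute)
    qed
  qed simp
qed

text \<open>Points that come close once stay close for ever after by equicontinuity, in particular
  at a later time of rigidity, when both are almost back at their starting positions.\<close>

lemma uniformly_distal:
  assumes "c > 0"
  obtains d where "d > 0"
    "\<And>x y n. x \<in> Y \<Longrightarrow> y \<in> Y \<Longrightarrow> dist x y \<ge> c \<Longrightarrow> dist ((g ^^ n) x) ((g ^^ n) y) \<ge> d"
proof -
  obtain d where d: "d > 0"
    "\<And>x y n. x \<in> Y \<Longrightarrow> y \<in> Y \<Longrightarrow> dist x y < d \<Longrightarrow> dist ((g ^^ n) x) ((g ^^ n) y) < c / 3"
    using equicontinuous[of "c / 3"] assms by auto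
  show thesis
  proof (rule that[OF d(1)], rule ccontr)
    fix x y n
    assume *: "x \<in> Y" "y \<in> Y" "dist x y \<ge> c" "\<not> dist ((g ^^ n) x) ((g ^^ n) y) \<ge> d"
    obtain m where m: "m \<ge> n" "\<And>y. y \<in> Y \<Longrightarrow> dist ((g ^^ m) y) y < c / 3"
      using uniformly_rigid[of "c / 3"] assms by auto
    have "dist ((g ^^ (m - n)) ((g ^^ n) x)) ((g ^^ (m - n)) ((g ^^ n) y)) < c / 3"
      using * by (intro d(2) mem) auto
    then have "dist ((g ^^ m) x) ((g ^^ m) y) < c / 3"
      using m(1) by (simp flip: funpow_add[THEN fun_cong, unfolded o_apply])
    then have "dist x y < c"
      using m(2)[of x] m(2)[of y] *(1,2) dist_triangle3[of x y "(g ^^ m) x"]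
        dist_triangle[of "(g ^^ m) x" y "(g ^^ m) y"] by linarith
    then show False using *(3) by simp
  qed
qed

lemma image_eq: "g ` Y = Y"
proof
  show "Y \<subseteq> g ` Y"
  proof
    fix y assume y: "y \<in> Y"
    have "closed (g ` Y)"
      using compact_continuous_image[OF cont compact] by (rule compact_imp_closed)
    moreover have "y \<in> closure (g ` Y)"
      unfolding closure_approachable
    proof (intro allI impI)
      fix e :: real assume "e > 0"
      then obtain n where n: "n \<ge> 1" "dist ((g ^^ n) y) y < e"
        using uniformly_rigid[of e 1] y by blast
      then obtain k where "n = Suc k" by (cases n) auto
      then have "(g ^^ n) y \<in> g ` Y" using mem[OF y] by simp
      then show "\<exists>z\<in>g ` Y. dist z y < e" using n by blast
    qed
    ultimately show "y \<in> g ` Y" by simp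
  qed
qed (rule inv)

end

section \<open>From transitivity to minimality and equicontinuity\<close>

lemma (in compact_system) minimal_equicontinuousI:
  assumes x: "x \<in> Y" "Y \<subseteq> closure {(g ^^ n) x |n. True}"
    and nsens: "\<not> sensitive_dependence_on Y g"
    and \<mu>: "finite_invariant_measure g \<mu>" "\<And>r. r > 0 \<Longrightarrow> measure \<mu> (ball x r \<inter> Y) > 0"
  shows "minimal_equicontinuous_system g Y"
proof
  note stable = transitive_point_stable[OF x nsens]
  have orbit: "\<exists>n. dist ((g ^^ n) x) z < e" if "z \<in> Y" "e > 0" for z e
    using x(2) that unfolding closure_approachable subset_iff by blast
  \<comment> \<open>The orbit of \<open>x\<close> comes so close to \<open>y\<close> that the two
    shadow each other for \<open>K\<close> steps. Within that time the orbit of \<open>x\<close> is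
    back near \<open>x\<close>, so the orbit of \<open>y\<close> gets there too.\<close>
  have to_x: "\<exists>n. dist ((g ^^ n) y) x < e" if y: "y \<in> Y" and "e > 0" for y e
  proof -
    have e: "e / 4 > 0" "e / 2 > 0" using \<open>e > 0\<close> by auto
    obtain K where K: "\<And>m. \<exists>i\<le>K. dist ((g ^^ i) ((g ^^ m) x)) x < 2 * (e / 4)"
      using syndetic_returns[OF x(1) stable[OF e(1)] e(1) \<mu>] by blast
    obtain d where d: "d > 0"
      "\<forall>z\<in>Y. dist y z < d \<longrightarrow> (\<forall>n\<le>K. dist ((g ^^ n) y) ((g ^^ n) z) < e / 2)"
      using initial_segment_near[OF y e(2)] by blast
    obtain m where m: "dist ((g ^^ m) x) y < d" using orbit[OF y d(1)] by blast
    obtain i where i: "i \<le> K" "dist ((g ^^ i) ((g ^^ m) x)) x < e / 2" using K[of m] by auto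
    have "dist ((g ^^ i) y) ((g ^^ i) ((g ^^ m) x)) < e / 2"
      using d(2) m i(1) mem[OF x(1)] by (metis dist_commute)
    then have "dist ((g ^^ i) y) x < e"
      using i(2) dist_triangle[of "(g ^^ i) y" x "(g ^^ i) ((g ^^ m) x)"] by linarith
    then show ?thesis by blast
  qed
  show "Y \<noteq> {}" using x(1) by blast
  show "\<exists>n. dist ((g ^^ n) y) z < e" if y: "y \<in> Y" and z: "z \<in> Y" and e: "e > 0" for y z e
  proof -
    obtain k where k: "dist ((g ^^ k) x) z < e / 2" using orbit[OF z, of "e / 2"] e by auto
    obtain d where d: "d > 0"
      "\<And>y. y \<in> Y \<Longrightarrow> dist x y < d \<Longrightarrow> dist ((g ^^ k) x) ((g ^^ k) y) < e / 2"
      using funpow_near[OF x(1), of "e / 2" k] e by auto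
    obtain n where n: "dist ((g ^^ n) y) x < d" using to_x[OF y d(1)] by blast
    have "dist ((g ^^ k) x) ((g ^^ k) ((g ^^ n) y)) < e / 2"
      using n by (intro d(2) mem y) (simp add: dist_commute)
    then have "dist ((g ^^ (k + n)) y) z < e"
      using k dist_triangle3[of "(g ^^ (k + n)) y" z "(g ^^ k) x"] by (simp add: funpow_add)
    then show ?thesis by blast
  qed
  \<comment> \<open>Each orbit enters the ball of stability around \<open>x\<close>, from where
    stability is pulled back to its start.\<close>
  have stable': "stable_at g Y e y" if y: "y \<in> Y" and e: "e > 0" for y e
  proof -
    obtain d where d: "d > 0"
      "\<And>y n. y \<in> Y \<Longrightarrow> dist x y < d \<Longrightarrow> dist ((g ^^ n) x) ((g ^^ n) y) < e / 2"
      using stable[of "e / 2"] e by (auto elim: stable_atD)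
    obtain n where n: "dist ((g ^^ n) y) x < d" using to_x[OF y d(1)] by blast
    have "stable_at g Y (2 * (e / 2)) ((g ^^ n) y)"
      using n by (intro stable_at_nearby[OF d] mem y) (simp_all add: dist_commute)
    then show ?thesis using stable_at_pullback y e by simp
  qed
  show "\<exists>d>0. \<forall>x\<in>Y. \<forall>y\<in>Y. dist x y < d \<longrightarrow> (\<forall>n. dist ((g ^^ n) x) ((g ^^ n) y) < e)"
    if e: "e > 0" for e
  proof -
    have pt: "\<exists>d>0. \<forall>h\<in>range (\<lambda>n. g ^^ n). \<forall>y\<in>Y. dist y z < d \<longrightarrow> dist (h y) (h z) < r"
      if "z \<in> Y" "0 < r" for z r
      using stable'[OF that] unfolding stable_at_def by (simp add: dist_commute) blast
    obtain d where "d > 0" "\<And>h z y. h \<in> range (\<lambda>n. g ^^ n) \<Longrightarrow> z \<in> Y \<Longrightarrow> y \<in> Y \<Longrightarrow>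
        dist y z < d \<Longrightarrow> dist (h y) (h z) < e"
      using compact_uniformly_equicontinuous[OF compact pt e] by metis
    then show ?thesis by blast
  qed
qed

section \<open>The topological support carries the measure\<close>

text \<open>The complement is a countable union of the compact sets \<open>C n\<close> of points at
  a definite distance from the support, and each of them is covered by finitely many open null
  sets.\<close>

lemma complement_topological_support_null:
  fixes \<mu> :: "'a::metric_space measure"
  assumes "sets \<mu> = sets borel" "compact (UNIV :: 'a set)" "topological_support \<mu> \<noteq> {}"
  shows "- topological_support \<mu> \<in> null_sets \<mu>"
proof -
  let ?S = "topological_support \<mu>"
  have nbhd: "\<exists>U. open U \<and> x \<in> U \<and> emeasure \<mu> U = 0" if "x \<notin> ?S" for x
    using that unfolding topological_support_def by (auto simp: not_gr_zero)
  have "open (- ?S)"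
  proof (subst open_subopen, intro ballI)
    fix x assume "x \<in> - ?S"
    then obtain U where U: "open U" "x \<in> U" "emeasure \<mu> U = 0" using nbhd by blast
    moreover have "U \<subseteq> - ?S" using U(1,3) unfolding topological_support_def by auto
    ultimately show "\<exists>T. open T \<and> x \<in> T \<and> T \<subseteq> - ?S" by blast
  qed
  then have "closed ?S" by (simp add: closed_def)
  define C where "C n = {x. infdist x ?S \<ge> 1 / real (Suc n)}" for n
  have closed_C: "closed (C n)" for n
    unfolding C_def by (intro closed_Collect_le continuous_intros)
  have "C n \<in> null_sets \<mu>" for n
  proof -
    have "compact (C n)" using closed_C assms(2) compact_Int_closed[of UNIV "C n"] by simp
    moreover have "C n \<inter> ?S = {}" unfolding C_def by auto
    ultimately obtain \<U> where \<U>: "finite \<U>" "C n \<subseteq> \<Union>\<U>" "\<And>U. U \<in> \<U> \<Longrightarrow> open U \<and> emeasure \<mu> U = 0"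
      using nbhd compactE[of "C n" "{U. open U \<and> emeasure \<mu> U = 0}"] by (smt (verit) Union_iff disjoint_iff mem_Collect_eq subset_iff)
    have "\<Union>\<U> \<in> null_sets \<mu>"
      using \<U>(1,3) assms(1) by (intro null_sets.finite_Union) auto
    then show ?thesis
      using \<U>(2) closed_C assms(1) by (rule_tac null_sets_subset) auto
  qed
  then have "(\<Union>n. C n) \<in> null_sets \<mu>" by (rule null_sets_UN)
  moreover have "- ?S = (\<Union>n. C n)"
  proof safe
    fix x assume "x \<notin> ?S"
    \<comment> \<open>\<open>infdist\<close> to the empty set is 0 by convention, hence the appeal
      to a nonempty support.\<close>
    then have "infdist x ?S > 0" using \<open>closed ?S\<close> assms(3) by (simp add: infdist_pos_not_in_closed)
    then obtain n where "1 / real (Suc n) < infdist x ?S" using nat_approx_posE by blast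
    then show "x \<in> (\<Union>n. C n)" unfolding C_def by (auto intro!: exI[of _ n])
  qed (auto simp: C_def)
  ultimately show ?thesis by simp
qed

lemma measure_ball_Int_topological_support_pos:
  fixes \<mu> :: "'a::metric_space measure"
  assumes "finite_measure \<mu>" "sets \<mu> = sets borel" "compact (UNIV :: 'a set)"
    and "x \<in> topological_support \<mu>" "r > 0"
  shows "measure \<mu> (ball x r \<inter> topological_support \<mu>) > 0"
proof -
  interpret finite_measure \<mu> by fact
  have null: "- topological_support \<mu> \<in> null_sets \<mu>"
    using complement_topological_support_null assms by blast
  have "emeasure \<mu> (ball x r) > 0"
    using assms unfolding topological_support_def by simp
  also have "emeasure \<mu> (ball x r) = emeasure \<mu> (ball x r - - topological_support \<mu>)"
    using null assms(2) by (intro emeasure_Diff_null_set[symmetric]) auto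
  finally show ?thesis by (simp add: Diff_eq emeasure_eq_measure)
qed

section \<open>Finite sets of hitting times\<close>

text \<open>A hitting time of \<open>c\<close> at half the radius also serves all points near
  \<open>c\<close> by equicontinuity, so compactness leaves finitely many times.\<close>

lemma (in minimal_equicontinuous_system) uniformly_minimal:
  assumes z: "z \<in> Y" and r: "r > 0"
  obtains F where "finite F" "\<And>y. y \<in> Y \<Longrightarrow> \<exists>n\<in>F. dist ((g ^^ n) y) z < r"
proof -
  obtain d where d: "d > 0"
    "\<And>x y n. x \<in> Y \<Longrightarrow> y \<in> Y \<Longrightarrow> dist x y < d \<Longrightarrow> dist ((g ^^ n) x) ((g ^^ n) y) < r / 2"
    using equicontinuous[of "r / 2"] r by auto
  have "\<exists>n. dist ((g ^^ n) y) z < r / 2" if "y \<in> Y" for y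
    using r by (intro minimal[OF that z]) simp
  then obtain n where n: "\<And>y. y \<in> Y \<Longrightarrow> dist ((g ^^ n y) y) z < r / 2" by metis
  obtain C where C: "C \<subseteq> Y" "finite C" "Y \<subseteq> (\<Union>c\<in>C. ball c d)"
    using compactE_image[OF compact, of Y "\<lambda>c. ball c d"] d(1) by force
  show thesis
  proof (rule that[of "n ` C"])
    fix y assume y: "y \<in> Y"
    then obtain c where c: "c \<in> C" "dist c y < d" using C(3) by auto
    then have "dist ((g ^^ n c) c) ((g ^^ n c) y) < r / 2" using d(2) C(1) y by blast
    moreover have "dist ((g ^^ n c) c) z < r / 2" using n C(1) c(1) by blast
    ultimately have "dist ((g ^^ n c) y) z < r"
      using dist_triangle3[of "(g ^^ n c) y" z "(g ^^ n c) c"] by linarith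
    then show "\<exists>k\<in>n ` C. dist ((g ^^ k) y) z < r" using c(1) by blast
  qed (use C in simp)
qed

lemma interior_UN_closed_empty:
  assumes "finite F" "\<And>n. n \<in> F \<Longrightarrow> closed (T n)" "\<And>n. n \<in> F \<Longrightarrow> interior (T n) = {}"
  shows "interior (\<Union>n\<in>F. T n) = {}"
  using assms
proof (induction F rule: finite_induct)
  case (insert n F)
  then show ?case using interior_closed_Un_empty_interior[of "T n" "\<Union>n\<in>F. T n"] by simp
qed simp

section \<open>The circle\<close>

lemma to_circle_add: "to_circle (x + y) = to_circle x + to_circle y"
  by (simp add: plus_circle.abs_eq)

lemma to_circle_0: "to_circle 0 = 0"
  by (simp add: zero_circle_def)

lemma dist_circle_add_left [simp]: "dist (a + b) (a + c) = dist b c" for a b c :: circle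
  by transfer (simp add: algebra_simps)

lemma dist_circle_add_right [simp]: "dist (b + a) (c + a) = dist b c" for a b c :: circle
  using dist_circle_add_left[of a b c] by (simp add: add.commute)

lemma continuous_on_to_circle: "continuous_on X to_circle"
  unfolding continuous_on_iff by (metis dist_real_def dist_to_circle_le le_less_trans)

lemma continuous_on_circle_add_const:
  fixes h :: "'a::topological_space \<Rightarrow> circle"
  assumes "continuous_on X h"
  shows "continuous_on X (\<lambda>x. h x + a)"
proof -
  have "continuous_on UNIV (\<lambda>x. x + a)" for a :: circle
    unfolding continuous_on_iff by auto
  from continuous_on_compose2[OF this assms] show ?thesis by simp
qed

text \<open>The representative of \<open>q\<close> closest to \<open>x\<close> turns a distance on
  the circle into a signed difference of reals, as needed to compare positions along an arc.\<close>

lemma to_circle_near: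
  assumes "dist q (to_circle x) < e"
  obtains y where "q = to_circle y" "\<bar>y - x\<bar> < e"
proof -
  obtain y where y: "q = to_circle y" by (rule circle_cases)
  show thesis
  proof
    show "q = to_circle (y - of_int (round (y - x)))" unfolding y by (simp add: to_circle_eq_iff)
    show "\<bar>y - of_int (round (y - x)) - x\<bar> < e"
      using assms unfolding y by (simp add: dist_circle.abs_eq algebra_simps)
  qed
qed

lemma compact_UNIV_circle: "compact (UNIV :: circle set)"
proof -
  have "q \<in> to_circle ` {0..1}" for q
  proof -
    obtain x where "q = to_circle x" by (rule circle_cases)
    then have "q = to_circle (frac x)" by (simp add: to_circle_eq_iff frac_def)
    then show ?thesis using frac_ge_0[of x] frac_lt_1[of x] by (auto intro!: image_eqI)
  qed
  then have "UNIV = to_circle ` {0..1}" by blast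
  then show ?thesis using compact_continuous_image[OF continuous_on_to_circle compact_Icc] by metis
qed

lemma irrational_rotation_dense:
  assumes "\<omega> \<notin> \<rat>" "e > 0"
  obtains n where "dist (a + to_circle (real n * \<omega>)) b < e"
proof -
  obtain x where x: "b - a = to_circle x" by (rule circle_cases)
  obtain h k where k: "k > 0" "\<bar>of_int k * \<omega> - of_int h - x\<bar> < e"
    using sequence_of_fractional_parts_is_dense[OF assms] by blast
  have "to_circle (real (nat k) * \<omega>) = to_circle (of_int k * \<omega> - of_int h)"
    using k(1) by (simp add: to_circle_eq_iff)
  then have "dist (to_circle (real (nat k) * \<omega>)) (b - a) < e"
    using k(2) dist_to_circle_le[of "of_int k * \<omega> - of_int h" x] x by simp
  then have "dist (a + to_circle (real (nat k) * \<omega>)) (a + (b - a)) < e"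
    unfolding dist_circle_add_left .
  then show thesis using that by (simp add: algebra_simps)
qed

lemma dist_same_fst [simp]: "dist (a, b) (a, c) = dist b c"
  by (simp add: dist_Pair_Pair)

section \<open>The extension over the rotation and its projection\<close>

locale minimal_equicontinuous_extension =
  minimal_equicontinuous_system f A
  for f :: "circle \<times> circle \<Rightarrow> circle \<times> circle" and A +
  fixes \<omega> :: real and fib :: "circle \<Rightarrow> circle \<Rightarrow> circle"
  assumes irrational: "\<omega> \<notin> \<rat>"
    and f_eq: "\<And>\<theta> \<xi>. f (\<theta>, \<xi>) = (\<theta> + to_circle \<omega>, fib \<theta> \<xi>)"
    and fib_homeo: "\<And>\<theta>. orientation_preserving_homeo (fib \<theta>)"
    and proper: "A \<noteq> UNIV"
begin

lemma fst_funpow: "fst ((f ^^ n) p) = fst p + to_circle (real n * \<omega>)"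
proof (induction n)
  case (Suc n)
  have "fst (f q) = fst q + to_circle \<omega>" for q
    using f_eq[of "fst q" "snd q"] by simp
  then show ?case
    using Suc by (simp add: algebra_simps flip: to_circle_add)
qed (simp add: to_circle_0)

lemma fst_image: "fst ` A = UNIV"
proof -
  have "closed (fst ` A)"
    using compact by (intro compact_imp_closed compact_continuous_image continuous_intros)
  moreover have "b \<in> closure (fst ` A)" for b
    unfolding closure_approachable
  proof (intro allI impI)
    fix e :: real assume "e > 0"
    obtain p where p: "p \<in> A" using nonempty by blast
    obtain n where "dist (fst p + to_circle (real n * \<omega>)) b < e"
      using irrational_rotation_dense[OF irrational \<open>e > 0\<close>] .
    then show "\<exists>y\<in>fst ` A. dist y b < e"
      using mem[OF p, of n] by (metis fst_funpow image_eqI)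
  qed
  ultimately show ?thesis by auto
qed

text \<open>A small piece \<open>S\<close> of \<open>A\<close> projects onto a set with interior, by
  the finite covering of the circle by rotated copies of its projection. Some iterate takes a point
  of \<open>S\<close> over the centre of that interval near to \<open>z\<close>, and equicontinuity
  takes all of \<open>S\<close> along, so the fibres around \<open>fst z\<close> have points near
  \<open>z\<close>.\<close>

lemma projection_uniformly_open:
  assumes e: "e > 0"
  obtains r where "r > 0"
    "\<And>z \<theta>. z \<in> A \<Longrightarrow> dist \<theta> (fst z) < r \<Longrightarrow> \<exists>x\<in>A. fst x = \<theta> \<and> dist x z < e"
proof -
  obtain d where d: "d > 0"
    "\<And>x y n. x \<in> A \<Longrightarrow> y \<in> A \<Longrightarrow> dist x y < d \<Longrightarrow> dist ((f ^^ n) x) ((f ^^ n) y) < e / 2"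
    using equicontinuous[of "e / 2"] e by auto
  obtain z0 where z0: "z0 \<in> A" using nonempty by blast
  \<comment> \<open>A closed ball keeps \<open>S\<close> compact; the radius \<open>d / 3\<close>
    keeps its diameter below \<open>d\<close>, so that iterates never separate its points by
    \<open>e / 2\<close>.\<close>
  define S where "S = A \<inter> cball z0 (d / 3)"
  have "compact S" unfolding S_def using compact by (rule compact_Int_closed) simp
  then have closed_S: "closed (fst ` S)"
    by (intro compact_imp_closed compact_continuous_image continuous_intros)
  obtain F where F: "finite F" "\<And>y. y \<in> A \<Longrightarrow> \<exists>n\<in>F. dist ((f ^^ n) y) z0 < d / 3"
    using uniformly_minimal[OF z0, of "d / 3"] d(1) by auto
  define T where "T n = (\<lambda>\<theta>. \<theta> + to_circle (real n * \<omega>)) -` (fst ` S)" for n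
  have "\<theta> \<in> (\<Union>n\<in>F. T n)" for \<theta>
  proof -
    have "\<theta> \<in> fst ` A" by (simp add: fst_image)
    then obtain y where y: "y \<in> A" "fst y = \<theta>" by blast
    obtain n where n: "n \<in> F" "dist ((f ^^ n) y) z0 < d / 3" using F(2) y(1) by blast
    then have "(f ^^ n) y \<in> S" using mem y(1) by (auto simp: S_def dist_commute)
    then have "\<theta> \<in> T n" unfolding T_def using fst_funpow[of n y] y(2) by (metis imageI vimageI)
    then show ?thesis using n(1) by blast
  qed
  then have "(\<Union>n\<in>F. T n) = UNIV" by blast
  moreover have "closed (T n)" for n
    unfolding T_def using closed_S continuous_on_id
    by (intro closed_vimage) (auto intro: continuous_on_circle_add_const)
  ultimately obtain n where "n \<in> F" "interior (T n) \<noteq> {}"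
    using interior_UN_closed_empty[OF F(1), of T] by force
  then obtain a r where r: "r > 0" "ball a r \<subseteq> T n" by (metis all_not_in_conv mem_interior)
  let ?b = "a + to_circle (real n * \<omega>)"
  have fib_S: "\<exists>x\<in>S. fst x = \<theta>" if "dist \<theta> ?b < r" for \<theta>
  proof -
    have "dist (\<theta> - to_circle (real n * \<omega>) + to_circle (real n * \<omega>)) ?b < r"
      using that by simp
    then have "\<theta> - to_circle (real n * \<omega>) \<in> ball a r"
      unfolding dist_circle_add_right by (simp add: dist_commute)
    then have "\<theta> - to_circle (real n * \<omega>) \<in> T n" using r(2) by blast
    then show ?thesis unfolding T_def by auto
  qed
  obtain x1 where x1: "x1 \<in> S" "fst x1 = ?b" using fib_S[of ?b] r(1) by auto
  show thesis
  proof (rule that[of "r / 2"])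
    fix z \<theta> assume z: "z \<in> A" and \<theta>: "dist \<theta> (fst z) < r / 2"
    obtain m where m: "dist ((f ^^ m) x1) z < min (r / 2) (e / 2)"
      using minimal[of x1 z "min (r / 2) (e / 2)"] x1(1) z r(1) e by (auto simp: S_def)
    let ?c = "to_circle (real m * \<omega>)"
    have "dist (fst ((f ^^ m) x1)) (fst z) < r / 2"
      using m dist_fst_le[of "(f ^^ m) x1" z] by linarith
    then have "dist \<theta> (?b + ?c) < r"
      using \<theta> dist_triangle2[of \<theta> "?b + ?c" "fst z"] by (simp add: fst_funpow x1(2))
    then have "dist (\<theta> - ?c + ?c) (?b + ?c) < r" by simp
    then have "dist (\<theta> - ?c) ?b < r" unfolding dist_circle_add_right .
    then obtain x where x: "x \<in> S" "fst x = \<theta> - ?c" using fib_S by blast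
    have "dist x x1 < d"
      using x(1) x1(1) d(1) dist_triangle3[of x x1 z0] by (simp add: S_def)
    then have "dist ((f ^^ m) x) ((f ^^ m) x1) < e / 2"
      using x(1) x1(1) by (intro d(2)) (auto simp: S_def)
    then have "dist ((f ^^ m) x) z < e"
      using m dist_triangle[of "(f ^^ m) x" z "(f ^^ m) x1"] by simp
    moreover have "(f ^^ m) x \<in> A" using mem x(1) by (auto simp: S_def)
    moreover have "fst ((f ^^ m) x) = \<theta>" using x(2) by (simp add: fst_funpow)
    ultimately show "\<exists>x\<in>A. fst x = \<theta> \<and> dist x z < e" by blast
  qed (use r in simp)
qed

section \<open>Gaps in the fibres\<close>

text \<open>The arc is open and lies on the positive side of \<open>p\<close> only. Its length is a
  real number rather than a distance on the circle, so that length 1 can express that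
  \<open>p\<close> in \<open>A\<close> is alone in its fibre.\<close>

definition free_arc :: "real \<Rightarrow> circle \<times> circle \<Rightarrow> bool" where
  "free_arc l p \<longleftrightarrow> (\<forall>u. 0 < u \<and> u < l \<longrightarrow> (fst p, snd p + to_circle u) \<notin> A)"

text \<open>The lift \<open>G\<close> of the fibre map carries an interval onto an interval and has
  degree one, so lengths up to 1 stay up to 1. The image arc is free because \<open>f\<close> maps
  \<open>A\<close> onto \<open>A\<close>: a point of \<open>A\<close> in it would have a preimage in
  \<open>A\<close>, which injectivity places inside the old gap.\<close>

lemma gap_image:
  assumes p: "p \<in> A" and l: "0 < l" "l \<le> 1" "free_arc l p"
  obtains l' where "0 < l'" "l' \<le> 1" "free_arc l' (f p)"
    "f (fst p, snd p + to_circle l) = (fst (f p), snd (f p) + to_circle l')"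
proof -
  obtain \<theta> s where ps: "p = (\<theta>, to_circle s)" by (metis circle_cases surj_pair)
  obtain G :: "real \<Rightarrow> real" where G: "continuous_on UNIV G" "strict_mono G"
    "\<And>x. G (x + 1) = G x + 1" "\<And>x. fib \<theta> (to_circle x) = to_circle (G x)"
    using fib_homeo[of \<theta>] unfolding orientation_preserving_homeo_def by blast
  have inj: "inj (fib \<theta>)"
    using fib_homeo[of \<theta>] unfolding orientation_preserving_homeo_def homeomorphism_def
    by (metis UNIV_I injI)
  show thesis
  proof (rule that[of "G (s + l) - G s"])
    show "0 < G (s + l) - G s" using G(2) l(1) by (simp add: strict_mono_def)
    have "G (s + l) \<le> G (s + 1)" using G(2) l(2) by (simp add: strict_mono_less_eq)
    then show "G (s + l) - G s \<le> 1" by (simp add: G(3))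
    show "f (fst p, snd p + to_circle l) = (fst (f p), snd (f p) + to_circle (G (s + l) - G s))"
      by (simp add: ps f_eq G(4) flip: to_circle_add)
    show "free_arc (G (s + l) - G s) (f p)"
      unfolding free_arc_def
    proof (intro allI impI notI)
      fix u assume u: "0 < u \<and> u < G (s + l) - G s"
        and "(fst (f p), snd (f p) + to_circle u) \<in> A"
      then have "(\<theta> + to_circle \<omega>, to_circle (G s + u)) \<in> f ` A"
        by (simp add: ps f_eq G(4) image_eq to_circle_add)
      then obtain b where b: "(\<theta>, b) \<in> A" "fib \<theta> b = to_circle (G s + u)"
        by (auto simp: f_eq)
      obtain v where v: "s \<le> v" "v \<le> s + l" "G v = G s + u"
        using IVT'[of G s "G s + u" "s + l"] u l(1) continuous_on_subset[OF G(1)] by auto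
      have "v \<noteq> s" "v \<noteq> s + l" using v(3) u by auto
      then have "(\<theta>, to_circle s + to_circle (v - s)) \<notin> A"
        using l(3) v(1,2) unfolding free_arc_def ps by auto
      moreover have "b = to_circle v" using inj G(4) v(3) b(2) by (metis injD)
      ultimately show False using b(1) by (simp flip: to_circle_add)
    qed
  qed
qed

lemma gap_iterates:
  assumes p: "p \<in> A" and l: "0 < l" "l \<le> 1" "free_arc l p"
  shows "\<exists>l'. 0 < l' \<and> l' \<le> 1 \<and> free_arc l' ((f ^^ n) p) \<and>
    (f ^^ n) (fst p, snd p + to_circle l) = (fst ((f ^^ n) p), snd ((f ^^ n) p) + to_circle l')"
proof (induction n)
  case 0
  then show ?case using l by auto
next
  case (Suc n)
  then obtain k where k: "0 < k" "k \<le> 1" "free_arc k ((f ^^ n) p)"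
    "(f ^^ n) (fst p, snd p + to_circle l) = (fst ((f ^^ n) p), snd ((f ^^ n) p) + to_circle k)"
    by blast
  obtain l' where "0 < l'" "l' \<le> 1" "free_arc l' (f ((f ^^ n) p))"
    "f (fst ((f ^^ n) p), snd ((f ^^ n) p) + to_circle k)
      = (fst (f ((f ^^ n) p)), snd (f ((f ^^ n) p)) + to_circle l')"
    using gap_image[OF mem[OF p] k(1-3)] .
  then show ?case using k(4) by auto
qed

text \<open>The fibre through a missing point lifts to a closed set \<open>L\<close> of reals that
  is invariant under integer shifts. The points of \<open>L\<close> nearest to the missing one on
  either side bound the gap, and periodicity keeps its length at most 1.\<close>

lemma gap_exists:
  obtains p l where "p \<in> A" "0 < l" "l \<le> 1" "free_arc l p" "(fst p, snd p + to_circle l) \<in> A"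
proof -
  obtain \<theta> t where t: "(\<theta>, to_circle t) \<notin> A" using proper by (metis UNIV_eq_I circle_cases surj_pair)
  define L where "L = {s. (\<theta>, to_circle s) \<in> A}"
  have "closed L"
  proof -
    have "continuous_on UNIV (\<lambda>s. (\<theta>, to_circle s))"
      by (intro continuous_intros continuous_on_to_circle)
    from closed_vimage[OF compact_imp_closed[OF compact] this] show ?thesis
      by (simp add: L_def vimage_def)
  qed
  have per: "s + of_int k \<in> L" if "s \<in> L" for s k
  proof -
    have "to_circle (s + of_int k) = to_circle s" by (simp add: to_circle_eq_iff)
    then show ?thesis using that by (simp add: L_def)
  qed
  obtain c where c: "c \<in> L" using fst_image unfolding L_def
    by (metis (mono_tags, lifting) UNIV_I circle_cases imageE mem_Collect_eq prod.collapse)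
  define X where "X = L \<inter> {..t}"
  define Z where "Z = L \<inter> {t..}"
  have "c + of_int (\<lfloor>t - c\<rfloor>) \<in> X" "c + of_int (\<lceil>t - c\<rceil>) \<in> Z"
    unfolding X_def Z_def using per[OF c] by (auto; linarith)+
  then have ne: "X \<noteq> {}" "Z \<noteq> {}" by auto
  have bdd: "bdd_above X" "bdd_below Z" unfolding X_def Z_def by auto
  have cl: "closed X" "closed Z" unfolding X_def Z_def using \<open>closed L\<close> by auto
  define a where "a = Sup X"
  define b where "b = Inf Z"
  have a: "a \<in> X" unfolding a_def using closed_contains_Sup[OF ne(1) bdd(1) cl(1)] .
  have b: "b \<in> Z" unfolding b_def using closed_contains_Inf[OF ne(2) bdd(2) cl(2)] .
  have "t \<notin> L" using t by (simp add: L_def)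
  then have ab: "a < t" "t < b" using a b by (auto simp: X_def Z_def order_less_le)
  have gap: "u \<notin> L" if "a < u" "u < b" for u
  proof
    assume "u \<in> L"
    then have "u \<in> X \<or> u \<in> Z" by (auto simp: X_def Z_def)
    then show False using that cSup_upper[OF _ bdd(1)] cInf_lower[OF _ bdd(2)]
      unfolding a_def b_def by (meson not_less)
  qed
  show thesis
  proof (rule that[of "(\<theta>, to_circle a)" "b - a"])
    show "(\<theta>, to_circle a) \<in> A" using a by (simp add: X_def L_def)
    show "0 < b - a" using ab by simp
    show "b - a \<le> 1"
    proof (rule ccontr)
      assume "\<not> b - a \<le> 1"
      then have "a + 1 < b" by simp
      moreover have "a + 1 \<in> L" using per[of a 1] a by (simp add: X_def)
      ultimately show False using gap[of "a + 1"] by simp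
    qed
    show "(fst (\<theta>, to_circle a), snd (\<theta>, to_circle a) + to_circle (b - a)) \<in> A"
      using b by (simp add: Z_def L_def flip: to_circle_add)
    show "free_arc (b - a) (\<theta>, to_circle a)"
      unfolding free_arc_def using gap by (auto simp: L_def simp flip: to_circle_add)
  qed
qed

lemma orbit_of_gaps:
  obtains p \<delta> where "p \<in> A" "\<delta> > 0" "\<And>n. free_arc \<delta> ((f ^^ n) p)"
proof -
  obtain p l where p: "p \<in> A" and l: "0 < l" "l \<le> 1" "free_arc l p"
    and q: "(fst p, snd p + to_circle l) \<in> A" by (rule gap_exists)
  let ?q = "(fst p, snd p + to_circle l)"
  have mono: "free_arc d x" if "free_arc l' x" "d \<le> l'" for d l' x
    using that unfolding free_arc_def by auto
  show thesis
  proof (cases "p = ?q")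
    \<comment> \<open>Distality is empty for coinciding end points. Here the length represents 0 on
      the circle and lies in \<open>(0, 1]\<close>, so it is 1 at every time.\<close>
    case True
    have "free_arc 1 ((f ^^ n) p)" for n
    proof -
      obtain l' where l': "0 < l'" "l' \<le> 1" "free_arc l' ((f ^^ n) p)"
        "(f ^^ n) ?q = (fst ((f ^^ n) p), snd ((f ^^ n) p) + to_circle l')"
        using gap_iterates[OF p l] by blast
      have "snd ((f ^^ n) p) + to_circle l' = snd ((f ^^ n) p)"
        using l'(4) True by (metis snd_conv)
      then have "to_circle l' = to_circle 0" by (simp add: to_circle_0)
      then have "l' \<in> \<int>" by (simp add: to_circle_eq_iff)
      then have "l' = 1" using l'(1,2) by (auto elim!: Ints_cases)
      then show ?thesis using l'(3) by simp
    qed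
    then show ?thesis using that[OF p, of 1] by simp
  next
    case False
    obtain \<delta> where \<delta>: "\<delta> > 0"
      "\<And>x y n. x \<in> A \<Longrightarrow> y \<in> A \<Longrightarrow> dist x y \<ge> dist p ?q \<Longrightarrow> dist ((f ^^ n) x) ((f ^^ n) y) \<ge> \<delta>"
      using uniformly_distal[of "dist p ?q"] False by (metis zero_less_dist_iff)
    have "free_arc \<delta> ((f ^^ n) p)" for n
    proof -
      obtain l' where l': "0 < l'" "l' \<le> 1" "free_arc l' ((f ^^ n) p)"
        "(f ^^ n) ?q = (fst ((f ^^ n) p), snd ((f ^^ n) p) + to_circle l')"
        using gap_iterates[OF p l] by blast
      have "\<delta> \<le> dist ((f ^^ n) p) ((f ^^ n) ?q)" using \<delta>(2)[OF p q] by simp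
      also have "\<dots> = dist (snd ((f ^^ n) p) + 0) (snd ((f ^^ n) p) + to_circle l')"
        using l'(4) by (metis add.right_neutral dist_same_fst prod.collapse)
      also have "\<dots> \<le> l'"
        unfolding dist_circle_add_left using dist_to_circle_le[of 0 l'] l'(1) by (simp add: to_circle_0)
      finally show ?thesis using mono[OF l'(3)] by simp
    qed
    then show ?thesis using that[OF p \<delta>(1)] by blast
  qed
qed

text \<open>Suppose a point of \<open>A\<close> lay in the arc ahead of \<open>z\<close>. Openness
  moves it into the fibre of an iterate of \<open>p\<close> close to \<open>z\<close>, where it
  lands in the arc that is known to be free.\<close>

lemma fibres_separated:
  obtains \<delta> where "\<delta> > 0" "\<And>p q. p \<in> A \<Longrightarrow> q \<in> A \<Longrightarrow> fst p = fst q \<Longrightarrow> dist p q < \<delta> \<Longrightarrow> p = q"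
proof -
  obtain p \<delta> where p: "p \<in> A" and \<delta>: "\<delta> > 0" "\<And>n. free_arc \<delta> ((f ^^ n) p)"
    by (rule orbit_of_gaps) blast
  have free: "free_arc \<delta> z" if z: "z \<in> A" for z
    unfolding free_arc_def
  proof (intro allI impI notI)
    fix u assume u: "0 < u \<and> u < \<delta>" and w: "(fst z, snd z + to_circle u) \<in> A" (is "?w \<in> A")
    obtain s where s: "snd z = to_circle s" by (rule circle_cases)
    \<comment> \<open>Both end positions move by less than \<open>e\<close>, so the offset changes
      by less than \<open>2 * e\<close> and remains strictly between 0 and
      \<open>\<delta>\<close>.\<close>
    define e where "e = min u (\<delta> - u) / 2"
    have e: "e > 0" "2 * e \<le> u" "2 * e \<le> \<delta> - u" using u by (auto simp: e_def)
    obtain r where r: "r > 0"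
      "\<And>z \<theta>. z \<in> A \<Longrightarrow> dist \<theta> (fst z) < r \<Longrightarrow> \<exists>x\<in>A. fst x = \<theta> \<and> dist x z < e"
      using projection_uniformly_open[OF e(1)] by blast
    obtain n where n: "dist ((f ^^ n) p) z < min r e"
      using minimal[OF p z, of "min r e"] r(1) e(1) by auto
    let ?x = "(f ^^ n) p"
    have "dist (fst ?x) (fst ?w) < r" using n dist_fst_le[of ?x z] by simp
    then obtain w' where w': "w' \<in> A" "fst w' = fst ?x" "dist w' ?w < e"
      using r(2)[OF w] by blast
    have "dist (snd ?x) (to_circle s) < e" using n dist_snd_le[of ?x z] by (simp add: s)
    then obtain s' where s': "snd ?x = to_circle s'" "\<bar>s' - s\<bar> < e" by (rule to_circle_near)
    have "dist (snd w') (to_circle (s + u)) < e"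
      using w'(3) dist_snd_le[of w' ?w] by (simp add: s to_circle_add)
    then obtain t' where t': "snd w' = to_circle t'" "\<bar>t' - (s + u)\<bar> < e" by (rule to_circle_near)
    have "0 < t' - s'" "t' - s' < \<delta>" using s'(2) t'(2) e by linarith+
    then have "(fst ?x, snd ?x + to_circle (t' - s')) \<notin> A"
      using \<delta>(2)[of n] unfolding free_arc_def by blast
    moreover have "(fst ?x, snd ?x + to_circle (t' - s')) = w'"
      using w'(2) t'(1) s'(1) by (simp add: prod_eq_iff flip: to_circle_add)
    ultimately show False using w'(1) by simp
  qed
  show thesis
  proof (rule that[OF \<delta>(1)], rule ccontr)
    fix p q assume *: "p \<in> A" "q \<in> A" "fst p = fst q" "dist p q < \<delta>" "p \<noteq> q"
    \<comment> \<open>Free arcs are one-sided, so the order of the nearby representatives decides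
      which of the two points has the other one ahead of it.\<close>
    obtain a where a: "snd p = to_circle a" by (rule circle_cases)
    have "dist (snd q) (to_circle a) < \<delta>"
      using *(4) dist_snd_le[of p q] by (simp add: a dist_commute)
    then obtain b where b: "snd q = to_circle b" "\<bar>b - a\<bar> < \<delta>" by (rule to_circle_near)
    have "a \<noteq> b" using *(3,5) a b(1) by (auto simp: prod_eq_iff)
    then consider "0 < b - a" "b - a < \<delta>" | "0 < a - b" "a - b < \<delta>" using b(2) by linarith
    then show False
    proof cases
      case 1
      then have "(fst p, snd p + to_circle (b - a)) \<notin> A" using free[OF *(1)] by (simp add: free_arc_def)
      moreover have "(fst p, snd p + to_circle (b - a)) = q"
        using *(3) b(1) by (simp add: prod_eq_iff a flip: to_circle_add)
      ultimately show False using *(2) by simp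
    next
      case 2
      then have "(fst q, snd q + to_circle (a - b)) \<notin> A" using free[OF *(2)] by (simp add: free_arc_def)
      moreover have "(fst q, snd q + to_circle (a - b)) = p"
        using *(3) b(1) by (simp add: prod_eq_iff a flip: to_circle_add)
      ultimately show False using *(1) by simp
    qed
  qed
qed

end

section \<open>Compact sets covering the circle\<close>

text \<open>No dynamics is left here: separated fibres and uniform openness give \<open>fst\<close>
  unique local sections of uniform size, which is what lifting paths requires.\<close>

locale circle_covering =
  fixes A :: "(circle \<times> 'b::metric_space) set" and \<delta> :: real
  assumes compact_A: "compact A"
    and \<delta>_pos: "\<delta> > 0"
    and separated: "\<And>p q. p \<in> A \<Longrightarrow> q \<in> A \<Longrightarrow> fst p = fst q \<Longrightarrow> dist p q < \<delta> \<Longrightarrow> p = q"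
    and uniformly_open: "\<And>e. e > 0 \<Longrightarrow>
      \<exists>r>0. \<forall>z\<in>A. \<forall>\<theta>. dist \<theta> (fst z) < r \<longrightarrow> (\<exists>x\<in>A. fst x = \<theta> \<and> dist x z < e)"
begin

text \<open>A lift of the path that runs around the base circle at unit speed; integer times are
  those at which it is back in the fibre of \<open>x\<close>.\<close>

definition lift_on :: "real \<Rightarrow> circle \<times> 'b \<Rightarrow> (real \<Rightarrow> circle \<times> 'b) \<Rightarrow> bool" where
  "lift_on T x \<gamma> \<longleftrightarrow> continuous_on {0..T} \<gamma> \<and> \<gamma> 0 = x \<and>
     (\<forall>t\<in>{0..T}. \<gamma> t \<in> A \<and> fst (\<gamma> t) = fst x + to_circle t)"

text \<open>The distance of the two lifts is continuous on a connected set and is either 0 or at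
  least \<open>\<delta>\<close>, so it cannot pass through \<open>\<delta> / 2\<close>.\<close>

lemma lifts_agree:
  fixes \<gamma> \<gamma>' :: "real \<Rightarrow> circle \<times> 'b"
  assumes "connected S" "continuous_on S \<gamma>" "continuous_on S \<gamma>'"
    and A: "\<And>t. t \<in> S \<Longrightarrow> \<gamma> t \<in> A" "\<And>t. t \<in> S \<Longrightarrow> \<gamma>' t \<in> A"
    and fst: "\<And>t. t \<in> S \<Longrightarrow> fst (\<gamma> t) = fst (\<gamma>' t)"
    and eq: "s \<in> S" "\<gamma> s = \<gamma>' s" and t: "t \<in> S"
  shows "\<gamma> t = \<gamma>' t"
proof (rule ccontr)
  assume neq: "\<gamma> t \<noteq> \<gamma>' t"
  let ?D = "\<lambda>t. dist (\<gamma> t) (\<gamma>' t)"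
  have "connected (?D ` S)"
    using assms(1-3) by (intro connected_continuous_image continuous_intros)
  moreover have "0 \<in> ?D ` S" using eq by force
  moreover have "?D t \<in> ?D ` S" "\<delta> / 2 \<le> ?D t"
    using t separated[OF A[OF t] fst[OF t]] neq \<delta>_pos by force+
  ultimately have "\<delta> / 2 \<in> ?D ` S"
    using \<delta>_pos by (meson connectedD_interval half_gt_zero less_imp_le)
  then obtain u where "u \<in> S" "?D u = \<delta> / 2" by auto
  then show False using separated[OF A[of u] fst[of u]] \<delta>_pos by auto
qed

text \<open>Openness puts a point near \<open>x\<close> in every nearby fibre, and separation makes
  it unique, hence continuous in the base point. The length \<open>h\<close> does not depend on
  \<open>x\<close>, so that lifts can be concatenated indefinitely.\<close>

lemma short_lifts:
  obtains h where "h > 0" "\<And>x. x \<in> A \<Longrightarrow> \<exists>\<gamma>. lift_on h x \<gamma>"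
proof -
  have "\<delta> / 3 > 0" using \<delta>_pos by simp
  then obtain r where r: "r > 0"
    "\<And>z \<theta>. z \<in> A \<Longrightarrow> dist \<theta> (fst z) < r \<Longrightarrow> \<exists>x\<in>A. fst x = \<theta> \<and> dist x z < \<delta> / 3"
    using uniformly_open by meson
  show thesis
  proof (rule that[of "r / 2"])
    fix x assume x: "x \<in> A"
    have "\<exists>y\<in>A. fst y = fst x + to_circle t \<and> dist y x < \<delta> / 3" if "t \<in> {0..r / 2}" for t
    proof (rule r(2)[OF x])
      have "dist (fst x + to_circle t) (fst x + 0) \<le> \<bar>t\<bar>"
        unfolding dist_circle_add_left using dist_to_circle_le[of t 0] by (simp add: to_circle_0)
      then show "dist (fst x + to_circle t) (fst x) < r" using that r(1) by simp
    qed
    then obtain \<gamma> where \<gamma>: "\<And>t. t \<in> {0..r / 2} \<Longrightarrow> \<gamma> t \<in> A"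
      "\<And>t. t \<in> {0..r / 2} \<Longrightarrow> fst (\<gamma> t) = fst x + to_circle t"
      "\<And>t. t \<in> {0..r / 2} \<Longrightarrow> dist (\<gamma> t) x < \<delta> / 3" by metis
    have "\<gamma> 0 = x"
      using \<gamma>[of 0] x r(1) \<delta>_pos by (intro separated) (auto simp: to_circle_0)
    moreover have "continuous_on {0..r / 2} \<gamma>"
      unfolding continuous_on_iff
    proof (intro ballI allI impI)
      fix t and e :: real assume t: "t \<in> {0..r / 2}" and "e > 0"
      \<comment> \<open>The route from the new point through \<open>\<gamma> t\<close> and
        \<open>x\<close> to \<open>\<gamma> t'\<close> has three parts below
        \<open>\<delta> / 3\<close>, so separation identifies its two ends.\<close>
      then have "min e (\<delta> / 3) > 0" using \<delta>_pos by simp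
      then obtain r' where r': "r' > 0" "\<And>z \<theta>. z \<in> A \<Longrightarrow> dist \<theta> (fst z) < r' \<Longrightarrow>
          \<exists>x\<in>A. fst x = \<theta> \<and> dist x z < min e (\<delta> / 3)"
        using uniformly_open by meson
      have "dist (\<gamma> t') (\<gamma> t) < e" if t': "t' \<in> {0..r / 2}" "dist t' t < r'" for t'
      proof -
        have "dist (fst x + to_circle t') (fst (\<gamma> t)) < r'"
          using dist_to_circle_le[of t' t] t'(2) \<gamma>(2)[OF t] by (simp add: dist_real_def)
        then obtain y where y: "y \<in> A" "fst y = fst x + to_circle t'" "dist y (\<gamma> t) < min e (\<delta> / 3)"
          using r'(2) \<gamma>(1)[OF t] by blast
        have "dist y (\<gamma> t') < \<delta>"
          using y(3) \<gamma>(3)[OF t] \<gamma>(3)[OF t'(1)] dist_triangle[of y "\<gamma> t'" "\<gamma> t"]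
            dist_triangle2[of "\<gamma> t" "\<gamma> t'" x] by simp
        then have "y = \<gamma> t'" using \<gamma>(1,2)[OF t'(1)] y(1,2) by (intro separated) auto
        then show ?thesis using y(3) by simp
      qed
      then show "\<exists>d>0. \<forall>t'\<in>{0..r / 2}. dist t' t < d \<longrightarrow> dist (\<gamma> t') (\<gamma> t) < e"
        using r'(1) by blast
    qed
    ultimately show "\<exists>\<gamma>. lift_on (r / 2) x \<gamma>" unfolding lift_on_def using \<gamma> by blast
  qed (use r in simp)
qed

lemma lift_on_subset:
  assumes "lift_on T x \<gamma>" "T' \<le> T"
  shows "lift_on T' x \<gamma>"
  using assms unfolding lift_on_def by (auto elim: continuous_on_subset)

lemma lift_exists:
  assumes "x \<in> A"
  obtains \<gamma> where "lift_on T x \<gamma>"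
proof -
  obtain h where h: "h > 0" "\<And>x. x \<in> A \<Longrightarrow> \<exists>\<gamma>. lift_on h x \<gamma>" by (rule short_lifts) blast
  have "\<exists>\<gamma>. lift_on (real k * h) x \<gamma>" for k
  proof (induction k)
    case 0
    show ?case by (rule exI[of _ "\<lambda>_. x"]) (use assms in \<open>auto simp: lift_on_def to_circle_0\<close>)
  next
    case (Suc k)
    let ?a = "real k * h"
    obtain \<gamma> where "lift_on ?a x \<gamma>" using Suc by blast
    then have \<gamma>: "continuous_on {0..?a} \<gamma>" "\<gamma> 0 = x" "\<And>t. t \<in> {0..?a} \<Longrightarrow> \<gamma> t \<in> A"
      "\<And>t. t \<in> {0..?a} \<Longrightarrow> fst (\<gamma> t) = fst x + to_circle t" unfolding lift_on_def by auto
    have a: "?a \<in> {0..?a}" using h(1) by simp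
    obtain \<sigma> where "lift_on h (\<gamma> ?a) \<sigma>" using h(2) \<gamma>(3)[OF a] by blast
    then have \<sigma>: "continuous_on {0..h} \<sigma>" "\<sigma> 0 = \<gamma> ?a" "\<And>t. t \<in> {0..h} \<Longrightarrow> \<sigma> t \<in> A"
      "\<And>t. t \<in> {0..h} \<Longrightarrow> fst (\<sigma> t) = fst (\<gamma> ?a) + to_circle t" unfolding lift_on_def by auto
    let ?g = "\<lambda>t. if t \<le> ?a then \<gamma> t else \<sigma> (t - ?a)"
    have "continuous_on {0..real (Suc k) * h} ?g"
    proof (rule continuous_on_cases_le)
      show "continuous_on {t \<in> {0..real (Suc k) * h}. t \<le> ?a} \<gamma>"
        by (rule continuous_on_subset[OF \<gamma>(1)]) auto
      show "continuous_on {t \<in> {0..real (Suc k) * h}. ?a \<le> t} (\<lambda>t. \<sigma> (t - ?a))"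
        by (rule continuous_on_compose2[OF \<sigma>(1)]) (auto intro!: continuous_intros simp: algebra_simps)
    qed (auto simp: \<sigma>(2))
    moreover have "?g t \<in> A \<and> fst (?g t) = fst x + to_circle t" if "t \<in> {0..real (Suc k) * h}" for t
    proof (cases "t \<le> ?a")
      case True
      then show ?thesis using \<gamma>(3,4) that by auto
    next
      case False
      then have "t - ?a \<in> {0..h}" using that by (auto simp: algebra_simps)
      then show ?thesis
        using False \<sigma>(3,4) \<gamma>(4)[OF a] by (simp add: add.assoc flip: to_circle_add)
    qed
    ultimately show ?case
      unfolding lift_on_def using \<gamma>(2) h(1) by (intro exI[of _ ?g]) auto
  qed
  moreover obtain k where "T \<le> real k * h"
    using reals_Archimedean3[OF h(1)] less_imp_le by blast
  ultimately show thesis using lift_on_subset that by blast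
qed

lemma finite_fibre: "finite {p \<in> A. fst p = \<theta>}"
proof (rule ccontr)
  let ?K = "{p \<in> A. fst p = \<theta>}"
  assume "infinite ?K"
  then obtain x where x: "x islimpt ?K"
    using Heine_Borel_imp_Bolzano_Weierstrass[OF compact_A, of ?K] by auto
  obtain y where y: "y \<in> ?K" "y \<noteq> x" "dist y x < \<delta> / 2"
    using x \<delta>_pos unfolding islimpt_approachable by (meson half_gt_zero)
  \<comment> \<open>Being strictly closer to the limit point than \<open>y\<close> makes
    \<open>z\<close> different from \<open>y\<close>.\<close>
  obtain z where z: "z \<in> ?K" "z \<noteq> x" "dist z x < dist y x"
    using x y(2) unfolding islimpt_approachable by (meson zero_less_dist_iff)
  have "dist y z < \<delta>" using y(3) z(3) dist_triangle2[of y z x] by simp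
  then have "y = z" using separated y(1) z(1) by auto
  then show False using z(3) by simp
qed

text \<open>Shifting time by \<open>k\<close> full turns leaves the base point unchanged, so the
  shifted path and \<open>\<gamma>\<close> are lifts of the same path; one coincidence makes them
  agree throughout.\<close>

lemma lift_shift:
  assumes \<gamma>: "lift_on T x \<gamma>" and eq: "\<gamma> s = \<gamma> (s + real k)"
    and s: "0 \<le> s" "s + real k \<le> T" and t: "0 \<le> t" "t + real k \<le> T"
  shows "\<gamma> t = \<gamma> (t + real k)"
proof (rule lifts_agree[of "{0..T - real k}" \<gamma> "\<lambda>t. \<gamma> (t + real k)" s])
  have c: "continuous_on {0..T} \<gamma>" using \<gamma> unfolding lift_on_def by blast
  show "continuous_on {0..T - real k} \<gamma>" by (rule continuous_on_subset[OF c]) auto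
  show "continuous_on {0..T - real k} (\<lambda>t. \<gamma> (t + real k))"
    by (rule continuous_on_compose2[OF c]) (auto intro!: continuous_intros)
  fix u assume u: "u \<in> {0..T - real k}"
  show "\<gamma> u \<in> A" "\<gamma> (u + real k) \<in> A" using \<gamma> u unfolding lift_on_def by auto
  have "to_circle (u + real k) = to_circle u" by (simp add: to_circle_eq_iff)
  then show "fst (\<gamma> u) = fst (\<gamma> (u + real k))" using \<gamma> u unfolding lift_on_def by auto
qed (use s t eq in auto)

text \<open>At integer times a lift is in one finite fibre, so it must return to its start.\<close>

lemma periodic_lift:
  assumes x: "x \<in> A"
  obtains \<gamma> N where "N \<ge> 1" "lift_on (3 * real N) x \<gamma>" "\<gamma> (real N) = x"
    "\<And>k. 1 \<le> k \<Longrightarrow> k < N \<Longrightarrow> \<gamma> (real k) \<noteq> x"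
proof -
  let ?K = "{p \<in> A. fst p = fst x}"
  define M where "M = card ?K"
  \<comment> \<open>The pigeonhole principle takes the \<open>M + 1\<close> integer times up to
    \<open>M\<close>. Three times that length leaves room for three full periods.\<close>
  obtain \<gamma> where \<gamma>: "lift_on (3 * real M) x \<gamma>" using lift_exists[OF x] .
  have "(\<lambda>k. \<gamma> (real k)) ` {0..M} \<subseteq> ?K"
  proof (rule image_subsetI)
    fix k assume k: "k \<in> {0..M}"
    then have "real k \<in> {0..3 * real M}" by auto
    moreover have "to_circle (real k) = to_circle 0" by (simp add: to_circle_eq_iff)
    ultimately show "\<gamma> (real k) \<in> ?K"
      using \<gamma> unfolding lift_on_def by (auto simp: to_circle_0)
  qed
  then have "card ((\<lambda>k. \<gamma> (real k)) ` {0..M}) \<le> M"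
    unfolding M_def by (intro card_mono finite_fibre)
  then have "\<not> inj_on (\<lambda>k. \<gamma> (real k)) {0..M}" by (intro pigeonhole) simp
  then obtain i j where ij: "i < j" "j \<le> M" "\<gamma> (real i) = \<gamma> (real j)"
    unfolding inj_on_def by (metis atLeastAtMost_iff linorder_neqE_nat)
  have "\<gamma> 0 = \<gamma> (0 + real (j - i))"
    by (rule lift_shift[OF \<gamma>, of "real i"]) (use ij in \<open>auto simp: of_nat_diff\<close>)
  moreover have \<gamma>0: "\<gamma> 0 = x" using \<gamma> unfolding lift_on_def by blast
  ultimately have ex: "1 \<le> j - i \<and> \<gamma> (real (j - i)) = x" using ij(1) by simp
  define N where "N = (LEAST n. 1 \<le> n \<and> \<gamma> (real n) = x)"
  have N: "1 \<le> N" "\<gamma> (real N) = x" using LeastI[of "\<lambda>n. 1 \<le> n \<and> \<gamma> (real n) = x", OF ex]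
    unfolding N_def by auto
  have "N \<le> j - i" unfolding N_def using ex by (rule Least_le)
  then have "lift_on (3 * real N) x \<gamma>" using ij(2) by (intro lift_on_subset[OF \<gamma>]) simp
  moreover have "\<gamma> (real k) \<noteq> x" if "1 \<le> k" "k < N" for k
    using not_less_Least[of k "\<lambda>n. 1 \<le> n \<and> \<gamma> (real n) = x"] that unfolding N_def by auto
  ultimately show thesis using that N by blast
qed

text \<open>One period of the lift traces a compact connected set \<open>C\<close>. Nearby points of
  \<open>A\<close> lie on the same lift, so \<open>C\<close> is also open in \<open>A\<close> and
  therefore a whole component.\<close>

lemma component_simple_closed_curve:
  assumes x: "x \<in> A"
  shows "simple_closed_curve (connected_component_set A x)"
    and "openin (top_of_set A) (connected_component_set A x)"
proof -
  obtain \<gamma> N where N: "N \<ge> 1" "lift_on (3 * real N) x \<gamma>" "\<gamma> (real N) = x"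
    "\<And>k. 1 \<le> k \<Longrightarrow> k < N \<Longrightarrow> \<gamma> (real k) \<noteq> x"
    using periodic_lift[OF x] by blast
  have \<gamma>: "continuous_on {0..3 * real N} \<gamma>" "\<gamma> 0 = x" "\<And>t. t \<in> {0..3 * real N} \<Longrightarrow> \<gamma> t \<in> A"
      "\<And>t. t \<in> {0..3 * real N} \<Longrightarrow> fst (\<gamma> t) = fst x + to_circle t"
    using N(2) unfolding lift_on_def by auto
  define C where "C = \<gamma> ` {0..real N}"
  have cont: "continuous_on {0..real N} \<gamma>" by (rule continuous_on_subset[OF \<gamma>(1)]) auto
  have C: "C \<subseteq> A" "connected C" "compact C" "x \<in> C"
    unfolding C_def using \<gamma>(2,3) cont
    by (auto intro: connected_continuous_image compact_continuous_image
        intro!: image_eqI[of _ _ 0])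
  have shift: "\<gamma> t = \<gamma> (t + real N)" if "t \<in> {0..2 * real N}" for t
    by (rule lift_shift[OF N(2), of 0]) (use that \<gamma>(2) N(3) in auto)
  have wrap: "\<gamma> t \<in> C" if t: "t \<in> {0..3 * real N}" for t
  proof -
    have step: "\<gamma> t \<in> C" if "t \<in> {real N..2 * real N}" for t
      using shift[of "t - real N"] that unfolding C_def by (auto intro!: image_eqI[of _ _ "t - real N"])
    consider "t \<in> {0..real N}" | "t \<in> {real N..2 * real N}" | "t - real N \<in> {real N..2 * real N}"
      using t by force
    then show ?thesis
    proof cases
      case 3
      then show ?thesis using step[OF 3] shift[of "t - real N"] by auto
    qed (auto simp: C_def step[unfolded C_def])
  qed
  have open_C: "openin (top_of_set A) C"
    unfolding openin_euclidean_subtopology_iff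
  proof (intro conjI ballI)
    fix y assume "y \<in> C"
    then obtain t0 where t0: "t0 \<in> {0..real N}" "y = \<gamma> t0" by (auto simp: C_def)
    \<comment> \<open>Moved into the middle period, the time can vary by up to 1 in either direction
      without leaving the domain of the lift, since \<open>N\<close> is at least 1.\<close>
    define t where "t = t0 + real N"
    have t: "t \<in> {real N..2 * real N}" "\<gamma> t = y" using t0 shift[of t0] by (auto simp: t_def)
    have t': "t \<in> {0..3 * real N}" using t(1) by auto
    obtain e where e: "e > 0"
      "\<And>s. s \<in> {0..3 * real N} \<Longrightarrow> dist s t < e \<Longrightarrow> dist (\<gamma> s) (\<gamma> t) < \<delta> / 2"
      using \<gamma>(1) t' \<delta>_pos unfolding continuous_on_iff by (meson half_gt_zero)
    obtain a where a: "fst x = to_circle a" by (rule circle_cases)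
    have "z \<in> C" if z: "z \<in> A" "dist z y < min (min e 1) (\<delta> / 2)" for z
    proof -
      have "dist (fst z) (to_circle (a + t)) < min e 1"
        using z(2) dist_fst_le[of z y] \<gamma>(4)[OF t'] t(2) by (simp add: a to_circle_add)
      then obtain v where v: "fst z = to_circle v" "\<bar>v - (a + t)\<bar> < min e 1" by (rule to_circle_near)
      have "real N \<ge> 1" using N(1) by simp
      then have s: "v - a \<in> {0..3 * real N}" using v(2) t(1) by (auto simp: abs_if split: if_splits)
      have "dist (\<gamma> (v - a)) (\<gamma> t) < \<delta> / 2" using v(2) by (intro e(2) s) (simp add: dist_real_def diff_diff_eq)
      then have "dist (\<gamma> (v - a)) z < \<delta>"
        using z(2) t(2) dist_triangle2[of "\<gamma> (v - a)" z y] by simp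
      moreover have "fst (\<gamma> (v - a)) = fst z"
        using \<gamma>(4)[OF s] by (simp add: a v(1) flip: to_circle_add)
      ultimately have "\<gamma> (v - a) = z" using separated \<gamma>(3)[OF s] z(1) by blast
      then show ?thesis using wrap[OF s] by simp
    qed
    then show "\<exists>e>0. \<forall>z\<in>A. dist z y < e \<longrightarrow> z \<in> C"
      using e(1) \<delta>_pos by (intro exI[of _ "min (min e 1) (\<delta> / 2)"]) auto
  qed (use C(1) in blast)
  have comp: "connected_component_set A x = C"
  proof
    show "C \<subseteq> connected_component_set A x"
      using C by (intro connected_component_maximal) auto
    let ?D = "connected_component_set A x"
    have sub: "?D \<subseteq> A" by (rule connected_component_subset)
    obtain U where U: "open U" "C = A \<inter> U" using open_C unfolding openin_open by blast
    then have "?D \<inter> C = ?D \<inter> U" using sub by blast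
    then have "openin (top_of_set ?D) (?D \<inter> C)" using U(1) by (simp add: openin_open_Int)
    moreover have "closedin (top_of_set ?D) (?D \<inter> C)"
      using compact_imp_closed[OF C(3)] by (rule closedin_closed_Int)
    moreover have "connected ?D" by simp
    moreover have "?D \<inter> C \<noteq> {}" using C(4) connected_component_refl[OF x] by blast
    ultimately show "?D \<subseteq> C" unfolding connected_clopen by blast
  qed
  then show "openin (top_of_set A) (connected_component_set A x)" using open_C by simp
  have "simple_path (\<lambda>t. \<gamma> (real N * t))"
    unfolding simple_path_def loop_free_def path_def
  proof (intro conjI ballI impI)
    show "continuous_on {0..1} (\<lambda>t. \<gamma> (real N * t))"
      by (rule continuous_on_compose2[OF cont]) (auto intro!: continuous_intros simp: mult_left_le)
    \<comment> \<open>Two times with the same value differ by an integer. Shifted back to 0, this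
      integer is a return time of \<open>x\<close>, hence at least \<open>N\<close>.\<close>
    have loop: "s = 0 \<and> t = real N" if st: "0 \<le> s" "s < t" "t \<le> real N" "\<gamma> s = \<gamma> t" for s t
    proof -
      have "fst x + to_circle s = fst x + to_circle t"
        using st \<gamma>(4)[of s] \<gamma>(4)[of t] by auto
      then have "t - s \<in> \<int>" by (metis add_left_cancel to_circle_eq_iff)
      then obtain k :: nat where k: "t - s = real k"
        using st(2) by (metis Ints_cases diff_gt_0_iff_gt of_int_0_less_iff of_int_of_nat_eq zero_less_imp_eq_int)
      have "\<gamma> 0 = \<gamma> (0 + real k)"
        by (rule lift_shift[OF N(2), of s]) (use st k in \<open>auto simp: algebra_simps\<close>)
      then have "\<not> k < N" using N(4)[of k] \<gamma>(2) k st(2) by (cases "k = 0") auto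
      then show ?thesis using k st by auto
    qed
    fix u v :: real assume uv: "u \<in> {0..1}" "v \<in> {0..1}" "\<gamma> (real N * u) = \<gamma> (real N * v)"
    have le: "real N * w \<le> real N" if "w \<in> {0..1}" for w using that by (simp add: mult_left_le)
    have N0: "real N > 0" using N(1) by simp
    show "u = v \<or> u = 0 \<and> v = 1 \<or> u = 1 \<and> v = 0"
    proof (cases u v rule: linorder_cases)
      case less
      then have "real N * u = 0 \<and> real N * v = real N"
        using uv N0 by (intro loop le) auto
      then show ?thesis using N0 by simp
    next
      case greater
      then have "real N * v = 0 \<and> real N * u = real N"
        using uv N0 by (intro loop le) auto
      then show ?thesis using N0 by simp
    qed simp
  qed
  moreover have "path_image (\<lambda>t. \<gamma> (real N * t)) = C"
  proof -
    have "(\<lambda>t. real N * t) ` {0..1} = {0..real N}"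
      using image_mult_atLeastAtMost[of "real N" 0 1] N(1) by (simp add: mult.commute)
    then show ?thesis unfolding path_image_def C_def by (metis image_image)
  qed
  ultimately show "simple_closed_curve (connected_component_set A x)"
    unfolding simple_closed_curve_def comp using \<gamma>(2) N(3)
    by (intro exI[of _ "\<lambda>t. \<gamma> (real N * t)"]) (simp add: pathfinish_def pathstart_def)
qed

end

section \<open>The cyclic action on the components\<close>

text \<open>A homeomorphism of \<open>Y\<close> permutes its components. As these are open, a dense
  orbit visits all of them, so they form a single orbit; \<open>n\<close> is the first return time
  to the component of \<open>x\<close>.\<close>

lemma (in minimal_equicontinuous_system) components_cyclically_permuted:
  assumes inj: "inj_on g Y"
    and curve: "\<And>x. x \<in> Y \<Longrightarrow> simple_closed_curve (connected_component_set Y x)"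
    and open_comp: "\<And>x. x \<in> Y \<Longrightarrow> openin (top_of_set Y) (connected_component_set Y x)"
  shows "cyclically_permuted_curves g Y"
proof -
  let ?C = "connected_component_set Y"
  have sub: "?C x \<subseteq> Y" for x by (rule connected_component_subset)
  have self: "x \<in> ?C x" if "x \<in> Y" for x
    using connected_component_refl[OF that] by simp
  have step: "g ` ?C x = ?C (g x)" if x: "x \<in> Y" for x
  proof
    have gx: "g x \<in> Y" using x inv by blast
    show "g ` ?C x \<subseteq> ?C (g x)"
      using x sub inv
      by (intro connected_component_maximal connected_continuous_image continuous_on_subset[OF cont])
        auto
    \<comment> \<open>By compactness the inverse of \<open>g\<close> on \<open>Y\<close> is
      continuous, so the component of \<open>g x\<close> also goes back into that of
      \<open>x\<close>.\<close>
    let ?h = "inv_into Y g"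
    have h: "continuous_on Y ?h"
      using continuous_on_inv[OF cont compact, of ?h] inj image_eq by simp
    have "?h ` ?C (g x) \<subseteq> ?C x"
    proof (rule connected_component_maximal)
      show "x \<in> ?h ` ?C (g x)" using x gx inj by (intro image_eqI[of _ _ "g x"]) auto
      show "connected (?h ` ?C (g x))"
        by (intro connected_continuous_image continuous_on_subset[OF h] sub) simp
      show "?h ` ?C (g x) \<subseteq> Y" using sub image_eq inv_into_into[of _ g Y] by blast
    qed
    moreover have "?C (g x) = g ` ?h ` ?C (g x)"
      using sub image_eq f_inv_into_f[of _ g Y] by (force simp: image_image)
    ultimately show "?C (g x) \<subseteq> g ` ?C x" by blast
  qed
  have steps: "(g ^^ n) ` ?C x = ?C ((g ^^ n) x)" if x: "x \<in> Y" for n x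
  proof (induction n)
    case (Suc n)
    have "(g ^^ Suc n) ` ?C x = g ` ((g ^^ n) ` ?C x)" by (simp add: image_comp)
    also have "\<dots> = ?C ((g ^^ Suc n) x)" using Suc step[OF mem[OF x]] by simp
    finally show ?case .
  qed simp
  have visit: "\<exists>n. ?C ((g ^^ n) x) = ?C y" if xy: "x \<in> Y" "y \<in> Y" for x y
  proof -
    obtain e where e: "e > 0" "\<And>z. z \<in> Y \<Longrightarrow> dist z y < e \<Longrightarrow> z \<in> ?C y"
      using open_comp[OF xy(2)] self[OF xy(2)] unfolding openin_euclidean_subtopology_iff by blast
    obtain n where "dist ((g ^^ n) x) y < e" using minimal[OF xy e(1)] by blast
    then have "(g ^^ n) x \<in> ?C y" using e(2) mem[OF xy(1)] by blast
    then show ?thesis using connected_component_eq by metis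
  qed
  obtain x where x: "x \<in> Y" using nonempty by blast
  \<comment> \<open>Looking from \<open>g x\<close> rather than from \<open>x\<close> makes the
    return time \<open>Suc m\<close> positive.\<close>
  obtain m where "?C ((g ^^ m) (g x)) = ?C x" using visit[of "g x" x] x inv by blast
  then have ex: "Suc m \<ge> 1 \<and> ?C ((g ^^ Suc m) x) = ?C x" by (simp add: funpow_swap1)
  define n where "n = (LEAST n. n \<ge> 1 \<and> ?C ((g ^^ n) x) = ?C x)"
  have n: "n \<ge> 1" "?C ((g ^^ n) x) = ?C x"
    using LeastI[of "\<lambda>n. n \<ge> 1 \<and> ?C ((g ^^ n) x) = ?C x", OF ex] unfolding n_def by auto
  have least: "?C ((g ^^ k) x) \<noteq> ?C x" if "1 \<le> k" "k < n" for k
    using not_less_Least[of k "\<lambda>n. n \<ge> 1 \<and> ?C ((g ^^ n) x) = ?C x"] that unfolding n_def by auto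
  have period: "?C ((g ^^ (k + n)) x) = ?C ((g ^^ k) x)" for k
    using steps[OF mem[OF x], of k n] steps[OF x, of k] n(2) by (simp add: funpow_add)
  have mod: "?C ((g ^^ (k mod n)) x) = ?C ((g ^^ k) x)" for k
  proof (induction k rule: less_induct)
    case (less k)
    show ?case
    proof (cases "k < n")
      case False
      then show ?thesis using less[of "k - n"] n(1) period[of "k - n"] by (simp add: mod_if)
    qed simp
  qed
  have inj_pow: "inj_on (g ^^ i) Y" for i
  proof (induction i)
    case (Suc i)
    have "inj_on g ((g ^^ i) ` Y)" using mem inj by (auto intro: inj_on_subset)
    then show ?case using comp_inj_on[OF Suc] by (simp only: funpow.simps)
  qed simp
  \<comment> \<open>Injectivity cancels the first \<open>i\<close> steps, so a coincidence would be
    a return before time \<open>n\<close>.\<close>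
  have distinct: "?C ((g ^^ i) x) \<noteq> ?C ((g ^^ j) x)" if ij: "i < j" "j < n" for i j
  proof
    assume eq: "?C ((g ^^ i) x) = ?C ((g ^^ j) x)"
    have "(g ^^ i) ((g ^^ (j - i)) x) = (g ^^ j) x"
      using ij(1) by (simp flip: funpow_add[THEN fun_cong, unfolded o_apply])
    then have "(g ^^ i) ` ?C x = (g ^^ i) ` ?C ((g ^^ (j - i)) x)"
      using eq steps[OF x, of i] steps[OF mem[OF x], of i "j - i"] by simp
    then have "?C x = ?C ((g ^^ (j - i)) x)"
      using inj_on_image_eq_iff[OF inj_pow sub sub] by blast
    moreover have "1 \<le> j - i" "j - i < n" using ij by linarith+
    ultimately show False using least by metis
  qed
  have "Y = (\<Union>i<n. ?C ((g ^^ i) x))"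
  proof
    show "Y \<subseteq> (\<Union>i<n. ?C ((g ^^ i) x))"
    proof
      fix y assume y: "y \<in> Y"
      then obtain k where "?C ((g ^^ k) x) = ?C y" using visit[OF x] by blast
      then have "y \<in> ?C ((g ^^ (k mod n)) x)" using mod[of k] self[OF y] by simp
      moreover have "k mod n < n" using n(1) by simp
      ultimately show "y \<in> (\<Union>i<n. ?C ((g ^^ i) x))" by blast
    qed
  qed (use sub in blast)
  moreover have "disjoint_family_on (\<lambda>i. ?C ((g ^^ i) x)) {..<n}"
    unfolding disjoint_family_on_def
    using distinct connected_component_disjoint connected_component_nonoverlap
    by (metis lessThan_iff linorder_neqE_nat)
  moreover have "g ` ?C ((g ^^ i) x) = ?C ((g ^^ (Suc i mod n)) x)" for i
    using step[OF mem[OF x]] mod[of "Suc i"] by simp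
  ultimately show ?thesis
    unfolding cyclically_permuted_curves_def
    using n(1) curve[OF mem[OF x]]
    by (intro exI[of _ n] exI[of _ "\<lambda>i. ?C ((g ^^ i) x)"]) blast
qed

context minimal_equicontinuous_extension
begin

lemma inj_f: "inj f"
proof (rule injI)
  fix p q assume eq: "f p = f q"
  obtain a b c d where pq: "p = (a, b)" "q = (c, d)" by (metis surj_pair)
  have "a = c" "fib a b = fib a d" using eq by (auto simp: pq f_eq)
  moreover have "inj (fib a)"
    using fib_homeo[of a] unfolding orientation_preserving_homeo_def homeomorphism_def
    by (metis UNIV_I injI)
  ultimately show "p = q" by (auto simp: pq dest: injD)
qed

lemma cyclically_permuted: "cyclically_permuted_curves f A"
proof -
  obtain \<delta> where \<delta>: "\<delta> > 0"
    "\<And>p q. p \<in> A \<Longrightarrow> q \<in> A \<Longrightarrow> fst p = fst q \<Longrightarrow> dist p q < \<delta> \<Longrightarrow> p = q"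
    by (rule fibres_separated) blast
  interpret circle_covering A \<delta>
  proof
    show "\<exists>r>0. \<forall>z\<in>A. \<forall>\<theta>. dist \<theta> (fst z) < r \<longrightarrow> (\<exists>x\<in>A. fst x = \<theta> \<and> dist x z < e)"
      if "e > 0" for e
      using projection_uniformly_open[OF that] by metis
  qed (use compact \<delta> in auto)
  show ?thesis
    using inj_f component_simple_closed_curve
    by (intro components_cyclically_permuted) (auto intro: inj_on_subset)
qed

end

theorem proposition3p5:
  fixes \<omega> :: real
    and f :: "circle \<times> circle \<Rightarrow> circle \<times> circle"
    and fib :: "circle \<Rightarrow> circle \<Rightarrow> circle"
    and A :: "(circle \<times> circle) set"
  assumes irrational: "\<omega> \<notin> \<rat>"
    and f_eq: "\<And>\<theta> \<xi>. f (\<theta>, \<xi>) = (\<theta> + to_circle \<omega>, fib \<theta> \<xi>)"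
    and f_cont: "continuous_on UNIV f"
    and fib_homeo: "\<And>\<theta>. orientation_preserving_homeo (fib \<theta>)"
    and A_proper: "A \<subset> UNIV"
    and A_compact: "compact A"
    and A_invariant: "f ` A \<subseteq> A"
    and A_perfect: "\<And>x. x \<in> A \<Longrightarrow> \<not> x isolated_in A"
    and A_transitive: "transitive_map_on A f"
    and A_support: "\<exists>\<mu>. finite_invariant_measure f \<mu> \<and> topological_support \<mu> = A"
  shows "sensitive_dependence_on A f \<or> cyclically_permuted_curves f A"
proof (rule disjCI)
  assume "\<not> cyclically_permuted_curves f A"
  show "sensitive_dependence_on A f"
  proof (rule ccontr)
    assume nsens: "\<not> sensitive_dependence_on A f"
    interpret compact_system f A
      by standard (use A_invariant A_compact continuous_on_subset[OF f_cont] in auto)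
    obtain x where x: "x \<in> A" "A \<subseteq> closure {(f ^^ n) x |n. True}"
      using A_transitive unfolding transitive_map_on_def by blast
    obtain \<mu> where \<mu>: "finite_invariant_measure f \<mu>" "topological_support \<mu> = A"
      using A_support by blast
    have "compact (UNIV :: (circle \<times> circle) set)"
      using compact_Times[OF compact_UNIV_circle compact_UNIV_circle] by simp
    then have "measure \<mu> (ball x r \<inter> A) > 0" if "r > 0" for r
      using measure_ball_Int_topological_support_pos[of \<mu> x r] \<mu> x(1) that
      unfolding finite_invariant_measure_def by simp
    then interpret minimal_equicontinuous_system f A
      using minimal_equicontinuousI[OF x nsens \<mu>(1)] by blast
    interpret minimal_equicontinuous_extension f A \<omega> fib
      by standard (use irrational f_eq fib_homeo A_proper in auto)
    show False using cyclically_permuted \<open>\<not> cyclically_permuted_curves f A\<close> by blast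
  qed
qed

end
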